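(* Let $\mathcal F$ be a class of Borel measurable real functions on a topological space $S$ with a finite envelope $F$. For a given $\mu\in\mathcal P(S)$, let $\delta:\mathcal P_0\to\mathbb R$, where $\mathcal P_0\subset\mathcal P(S)$ is a convex subset such that $\mu\in\mathcal P_0$ and $\int F\,d\nu<\infty$ for all $\nu\in\mathcal P_0$. Consider estimating $\delta$ at $\mu$ from i.i.d. data $X_1,\dots,X_n\sim\mu$. Set $$\dot{\mathcal P}_{0,\mu}=\{h:\ h:S\to\mathbb R\text{ is bounded and measurable with }\mu\text{-mean zero}\}.$$ Suppose that (a) $\mathcal F$ is $\mu$-pre-Gaussian, i.e., there exists a tight mean-zero Gaussian process $G_\mu=(G_\mu(f))_{f\in\mathcal F}$ in $\ell^\infty(\mathcal F)$ with covariance function $\mathrm{Cov}(G_\mu(f),G_\mu(g))=\mathrm{Cov}_\mu(f,g)$; (b) for every $h\in\dot{\mathcal P}_{0,\mu}$, $(1+th)\mu\in\mathcal P_0$ for sufficiently small $t>0$; (c) there exists a continuous linear functional $\delta'_\mu:\ell^\infty(\mathcal F)\to\mathbb R$ such that $$\delta'_\mu(\nu-\mu)=\lim_{t\downarrow0}\frac{\delta(\mu+t(\nu-\mu))-\delta(\mu)}{t}$$ holds for every $\nu\in\mathcal P_0$ of the form $\nu=(1+h)\mu$ for some $h\in\dot{\mathcal P}_{0,\mu}$. Then the semiparametric efficiency bound for estimating $\delta$ at $\mu$ relative to the tangent space $\dot{\mathcal P}_{0,\mu}$ agrees with $\mathrm{Var}(\delta'_\mu(G_\mu))$.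
   Context: $\mathcal P(S)$ is the set of Borel probability measures on $S$; $h\mu$ denotes the signed measure $h\,d\mu$. An envelope of $\mathcal F$ is a measurable $F\ge 0$ with $|f|\le F$ for all $f\in\mathcal F$. $\ell^\infty(\mathcal F)$ is the space of bounded real functions on $\mathcal F$ with the sup-norm; a finite signed measure $\gamma$ is identified with $f\mapsto\int f\,d\gamma$. $\mathrm{Cov}_\mu(f,g)=\mu(fg)-\mu(f)\mu(g)$. Semiparametric efficiency bound. Consider a functional $\kappa:\mathcal P\subset\mathcal P(S)\to\mathbb R$ and $\mu\in\mathcal P$. A submodel $\{\mu_t:0\le t<\epsilon'\}\subset\mathcal P$ with $\mu_0=\mu$ has score function $h:S\to\mathbb R$ if $\int[t^{-1}(d\mu_t^{1/2}-d\mu^{1/2})-\tfrac12h\,d\mu^{1/2}]^2\to0$ as $t\downarrow0$ (densities w.r.t. a common dominating measure). A tangent set $\dot{\mathcal P}_\mu\subset L^2(\mu)$ is the set of score functions of a collection of such submodels; it is a tangent space if it is a vector subspace. $\kappa$ is differentiable at $\mu$ relative to $\dot{\mathcal P}_\mu$ if there is a continuous linear functional $\dot\kappa_\mu:L^2(\mu)\to\mathbb R$ such that $t^{-1}(\kappa(\mu_t)-\kappa(\mu))\to\dot\kappa_\mu h$ as $t\downarrow0$ for every $h\in\dot{\mathcal P}_\mu$ and submodel $\mu_t$ (in the collection) with score $h$. The semiparametric efficiency bound relative to $\dot{\mathcal P}_\mu$ is $\sup_{h\in\mathrm{lin}(\dot{\mathcal P}_\mu),h\ne0}(\dot\kappa_\mu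 h)^2/\|h\|_{L^2(\mu)}^2$. Here $\dot{\mathcal P}_{0,\mu}$ is the tangent space corresponding to the submodels $\mu_t=(1+th)\mu$ ($t\ge 0$ small), $h\in\dot{\mathcal P}_{0,\mu}$. *)

theory Defs
  imports "HOL-Probability.Probability"
begin

section \<open>The space of bounded functions on a class of functions\<close>

text \<open>Elements are extensional (\<^term>\<open>undefined\<close> off the class), so that functions on the class
  are compared on the class only; \<^const>\<open>funspace\<close> carries the sup-metric.\<close>

definition linf :: "('a \<Rightarrow> real) set \<Rightarrow> (('a \<Rightarrow> real) \<Rightarrow> real) metric" where
  "linf \<F> = funspace \<F> euclidean_metric"

definition continuous_linear_linf ::
    "('a \<Rightarrow> real) set \<Rightarrow> ((('a \<Rightarrow> real) \<Rightarrow> real) \<Rightarrow> real) \<Rightarrow> bool" where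
  "continuous_linear_linf \<F> L \<longleftrightarrow>
     (\<forall>z \<in> mspace (linf \<F>). \<forall>w \<in> mspace (linf \<F>). \<forall>a b :: real.
        L (restrict (\<lambda>f. a * z f + b * w f) \<F>) = a * L z + b * L w) \<and>
     continuous_map (mtopology_of (linf \<F>)) euclidean L"

definition diff_linf ::
    "('a \<Rightarrow> real) set \<Rightarrow> 'a measure \<Rightarrow> 'a measure \<Rightarrow> (('a \<Rightarrow> real) \<Rightarrow> real)" where
  "diff_linf \<F> \<nu> \<mu> = restrict (\<lambda>f. (\<integral>x. f x \<partial>\<nu>) - (\<integral>x. f x \<partial>\<mu>)) \<F>"

definition envelope :: "('a::topological_space \<Rightarrow> real) set \<Rightarrow> ('a \<Rightarrow> real) \<Rightarrow> bool" where
  "envelope \<F> F \<longleftrightarrow> F \<in> borel_measurable borel \<and> (\<forall>x. 0 \<le> F x) \<and> (\<forall>f\<in>\<F>. \<forall>x. \<bar>f x\<bar> \<le> F x)"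


section \<open>Gaussian processes\<close>

definition covar :: "'b measure \<Rightarrow> ('b \<Rightarrow> real) \<Rightarrow> ('b \<Rightarrow> real) \<Rightarrow> real" where
  "covar M X Y = (\<integral>x. X x * Y x \<partial>M) - (\<integral>x. X x \<partial>M) * (\<integral>x. Y x \<partial>M)"

text \<open>The case \<open>s = 0\<close> covers the degenerate normal laws, which have no density.\<close>

definition gaussian_rv :: "'b measure \<Rightarrow> ('b \<Rightarrow> real) \<Rightarrow> bool" where
  "gaussian_rv M X \<longleftrightarrow> X \<in> borel_measurable M \<and>
     (\<exists>m s. 0 \<le> s \<and> distr M borel X =
        (if s = 0 then return borel m else density lborel (\<lambda>x. ennreal (normal_density m s x))))"

text \<open>Joint normality of the finite-dimensional marginals is expressed by normality of all their
  linear combinations.\<close>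

definition gaussian_process ::
    "'b measure \<Rightarrow> 'i set \<Rightarrow> ('b \<Rightarrow> 'i \<Rightarrow> real) \<Rightarrow> bool" where
  "gaussian_process M I G \<longleftrightarrow>
     (\<forall>J c. finite J \<and> J \<subseteq> I \<longrightarrow> gaussian_rv M (\<lambda>\<omega>. \<Sum>i\<in>J. c i * G \<omega> i))"

definition tight_random_element :: "'b measure \<Rightarrow> 'c metric \<Rightarrow> ('b \<Rightarrow> 'c) \<Rightarrow> bool" where
  "tight_random_element M m X \<longleftrightarrow>
     X \<in> measurable M (sigma (mspace m) {U. openin (mtopology_of m) U}) \<and>
     (\<forall>e>0. \<exists>K. compactin (mtopology_of m) K \<and>
        measure M {\<omega> \<in> space M. X \<omega> \<in> K} \<ge> 1 - e)"

text \<open>The conjunct on square integrability is what makes \<open>Cov\<^sub>\<mu>(f,g)\<close> meaningful: Bochner integrals of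
  non-integrable functions are \<open>0\<close> by convention.\<close>

definition pre_gaussian_process ::
    "'a::topological_space measure \<Rightarrow> ('a \<Rightarrow> real) set \<Rightarrow> 'b measure \<Rightarrow>
     ('b \<Rightarrow> ('a \<Rightarrow> real) \<Rightarrow> real) \<Rightarrow> bool" where
  "pre_gaussian_process \<mu> \<F> M G \<longleftrightarrow>
     prob_space M \<and>
     (\<forall>f\<in>\<F>. integrable \<mu> (\<lambda>x. (f x)\<^sup>2)) \<and>
     tight_random_element M (linf \<F>) G \<and>
     gaussian_process M \<F> G \<and>
     (\<forall>f\<in>\<F>. (\<integral>\<omega>. G \<omega> f \<partial>M) = 0) \<and>
     (\<forall>f\<in>\<F>. \<forall>g\<in>\<F>. covar M (\<lambda>\<omega>. G \<omega> f) (\<lambda>\<omega>. G \<omega> g) = covar \<mu> f g)"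


section \<open>Sets of probability measures\<close>

text \<open>\<open>(1 - t) \<mu> + t \<nu> = \<mu> + t (\<nu> - \<mu>)\<close>, for \<open>t\<close> in the unit interval.\<close>

definition mixture :: "real \<Rightarrow> 'a::topological_space measure \<Rightarrow> 'a measure \<Rightarrow> 'a measure" where
  "mixture t \<mu> \<nu> = measure_of UNIV (sets borel)
     (\<lambda>A. ennreal (1 - t) * emeasure \<mu> A + ennreal t * emeasure \<nu> A)"

definition convex_measures :: "'a::topological_space measure set \<Rightarrow> bool" where
  "convex_measures P \<longleftrightarrow> (\<forall>\<mu>\<in>P. \<forall>\<nu>\<in>P. \<forall>t. 0 \<le> t \<and> t \<le> 1 \<longrightarrow> mixture t \<mu> \<nu> \<in> P)"

text \<open>The measure \<open>(1 + h) \<mu>\<close>. Negative values of \<open>1 + h\<close> are truncated by \<^const>\<open>ennreal\<close>; for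
  \<open>h\<close> with \<open>\<mu>\<close>-mean zero the result is a probability measure only if \<open>1 + h \<ge> 0\<close> almost everywhere, so
  membership of \<open>tilt \<mu> h\<close> in a set of probability measures excludes truncation.\<close>

definition tilt :: "'a measure \<Rightarrow> ('a \<Rightarrow> real) \<Rightarrow> 'a measure" where
  "tilt \<mu> h = density \<mu> (\<lambda>x. ennreal (1 + h x))"


section \<open>Semiparametric efficiency\<close>

text \<open>Elements of \<open>L\<^sup>2(\<mu>)\<close> are represented by functions; continuity with respect to the seminorm
  \<open>l2_norm\<close> forces linear functionals to respect equality almost everywhere.\<close>

definition l2 :: "'a::topological_space measure \<Rightarrow> ('a \<Rightarrow> real) set" where
  "l2 \<mu> = {h \<in> borel_measurable borel. integrable \<mu> (\<lambda>x. (h x)\<^sup>2)}"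

definition l2_norm :: "'a measure \<Rightarrow> ('a \<Rightarrow> real) \<Rightarrow> real" where
  "l2_norm \<mu> h = sqrt (\<integral>x. (h x)\<^sup>2 \<partial>\<mu>)"

definition continuous_linear_l2 ::
    "'a::topological_space measure \<Rightarrow> (('a \<Rightarrow> real) \<Rightarrow> real) \<Rightarrow> bool" where
  "continuous_linear_l2 \<mu> D \<longleftrightarrow>
     (\<forall>g\<in>l2 \<mu>. \<forall>h\<in>l2 \<mu>. \<forall>a b :: real. D (\<lambda>x. a * g x + b * h x) = a * D g + b * D h) \<and>
     (\<forall>g\<in>l2 \<mu>. \<forall>e>0. \<exists>d>0. \<forall>h\<in>l2 \<mu>. l2_norm \<mu> (\<lambda>x. h x - g x) < d \<longrightarrow> \<bar>D h - D g\<bar> < e)"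

text \<open>A submodel is a curve \<open>m\<close> of measures, of which only the values at small \<open>t \<ge> 0\<close> matter.\<close>

definition submodel ::
    "'a measure set \<Rightarrow> 'a measure \<Rightarrow> (real \<Rightarrow> 'a measure) \<Rightarrow> bool" where
  "submodel P \<mu> m \<longleftrightarrow> m 0 = \<mu> \<and> (\<exists>\<epsilon>>0. \<forall>t. 0 \<le> t \<and> t < \<epsilon> \<longrightarrow> m t \<in> P)"

text \<open>Differentiability in quadratic mean; the integral is taken in the extended nonnegative reals, so
  that it is not \<open>0\<close> for want of integrability.\<close>

definition has_score ::
    "'a::topological_space measure \<Rightarrow> (real \<Rightarrow> 'a measure) \<Rightarrow> ('a \<Rightarrow> real) \<Rightarrow> bool" where
  "has_score \<mu> m h \<longleftrightarrow> h \<in> borel_measurable borel \<and>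
     (\<exists>N. sigma_finite_measure N \<and> sets N = sets borel \<and> absolutely_continuous N \<mu> \<and>
        (\<forall>\<^sub>F t in at_right 0. absolutely_continuous N (m t)) \<and>
        ((\<lambda>t. \<integral>\<^sup>+x. ennreal
            (((sqrt (enn2real (RN_deriv N (m t) x)) - sqrt (enn2real (RN_deriv N \<mu> x))) / t
              - (1/2) * h x * sqrt (enn2real (RN_deriv N \<mu> x)))\<^sup>2) \<partial>N)
          \<longlongrightarrow> 0) (at_right 0))"

text \<open>\<open>T\<close> is the tangent set at \<open>\<mu>\<close> of the collection \<open>C\<close> of submodels: up to equality almost everywhere
  (scores are unique only to that extent), \<open>T\<close> consists of the scores of members of \<open>C\<close>.\<close>

definition tangent_set ::
    "'a::topological_space measure set \<Rightarrow> 'a measure \<Rightarrow> (real \<Rightarrow> 'a measure) set \<Rightarrow>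
     ('a \<Rightarrow> real) set \<Rightarrow> bool" where
  "tangent_set P \<mu> C T \<longleftrightarrow>
     T \<subseteq> l2 \<mu> \<and>
     (\<forall>m\<in>C. submodel P \<mu> m) \<and>
     (\<forall>m\<in>C. \<exists>h\<in>T. has_score \<mu> m h) \<and>
     (\<forall>h\<in>T. \<exists>m\<in>C. has_score \<mu> m h)"

definition lin :: "('a \<Rightarrow> real) set \<Rightarrow> ('a \<Rightarrow> real) set" where
  "lin T = {(\<lambda>x. \<Sum>g\<in>A. c g * g x) | A c. finite A \<and> A \<subseteq> T}"

definition tangent_space ::
    "'a::topological_space measure set \<Rightarrow> 'a measure \<Rightarrow> (real \<Rightarrow> 'a measure) set \<Rightarrow>
     ('a \<Rightarrow> real) set \<Rightarrow> bool" where
  "tangent_space P \<mu> C T \<longleftrightarrow> tangent_set P \<mu> C T \<and> lin T \<subseteq> T"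

text \<open>\<open>D\<close> is a derivative of \<open>\<kappa>\<close> at \<open>\<mu>\<close> relative to the tangent set \<open>T\<close> of the collection \<open>C\<close>.\<close>

definition has_pathwise_derivative ::
    "('a::topological_space measure \<Rightarrow> real) \<Rightarrow> 'a measure \<Rightarrow> (real \<Rightarrow> 'a measure) set \<Rightarrow>
     ('a \<Rightarrow> real) set \<Rightarrow> (('a \<Rightarrow> real) \<Rightarrow> real) \<Rightarrow> bool" where
  "has_pathwise_derivative \<kappa> \<mu> C T D \<longleftrightarrow>
     continuous_linear_l2 \<mu> D \<and>
     (\<forall>h\<in>T. \<forall>m\<in>C. has_score \<mu> m h \<longrightarrow>
        ((\<lambda>t. (\<kappa> (m t) - \<kappa> \<mu>) / t) \<longlongrightarrow> D h) (at_right 0))"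

text \<open>The supremum is taken in the extended nonnegative reals: it is \<open>0\<close> if no \<open>h\<close> is nonzero in
  \<open>L\<^sup>2(\<mu>)\<close>.\<close>

definition efficiency_bound ::
    "'a measure \<Rightarrow> ('a \<Rightarrow> real) set \<Rightarrow> (('a \<Rightarrow> real) \<Rightarrow> real) \<Rightarrow> ennreal" where
  "efficiency_bound \<mu> T D =
     (SUP h \<in> {h \<in> lin T. l2_norm \<mu> h \<noteq> 0}. ennreal ((D h)\<^sup>2 / (l2_norm \<mu> h)\<^sup>2))"

definition bounded_scores :: "'a::topological_space measure \<Rightarrow> ('a \<Rightarrow> real) set" where
  "bounded_scores \<mu> =
     {h \<in> borel_measurable borel. bounded (range h) \<and> (\<integral>x. h x \<partial>\<mu>) = 0}"

definition linear_submodels ::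
    "'a::topological_space measure \<Rightarrow> (real \<Rightarrow> 'a measure) set" where
  "linear_submodels \<mu> = (\<lambda>h t. tilt \<mu> (\<lambda>x. t * h x)) ` bounded_scores \<mu>"

end

theory Submission
  imports Defs
begin

text \<open>Run along a tilted path \<open>(1 + t h) \<mu>\<close>, hypothesis (c) says that \<open>\<delta>\<close> has derivative
\<open>D h = \<delta>'(h \<mu>)\<close>, where \<open>h \<mu>\<close> stands for the bounded function \<open>f \<mapsto> Cov\<^sub>\<mu>(f, h)\<close> on the class: the path
is the mixture path from \<open>\<mu>\<close> to \<open>(1 + s h) \<mu>\<close> for a small \<open>s\<close>, traversed at another speed. The efficiency
bound is therefore the squared norm of \<open>D\<close> on the mean-zero part of \<open>L\<^sup>2(\<mu>)\<close>, and the task is to show that this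
norm is the standard deviation of \<open>\<delta>'(G)\<close>.

Both quantities are computed from one finite approximation. By tightness, \<open>G\<close> lies with high
probability in a compact set of bounded functions, and the members of a compact set are simultaneously within \<open>\<eta>\<close>
of their compositions with a map \<open>r\<close> of the class into itself that has finite range
(\<open>compact_linf_step_approximation\<close>). Applied to \<open>G \<circ> r\<close>, the functional \<open>\<delta>'\<close> yields a finite combination
\<open>Y = (\<Sum>g. c\<^sub>g G(g))\<close>. Put \<open>k = (\<Sum>g. c\<^sub>g g)\<close>; since \<open>G\<close> has the covariances of the class under \<open>\<mu>\<close>,
\<open>Y\<close> and \<open>k\<close> have the same standard deviation.

Two facts make the approximation effective, and both rest on the remark that a centred normal
variable exceeding \<open>a\<close> in absolute value with probability at most \<open>1/2\<close> has standard deviation at most \<open>2 a\<close>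
(\<open>gaussian_small_ball\<close>).

\<^item> The combinations \<open>Y\<close> converge to \<open>\<delta>'(G)\<close> in probability. Their differences are centred and Gaussian, so
  they are Cauchy in mean square, and by Fatou's lemma the limit \<open>\<delta>'(G)\<close> is close to \<open>Y\<close> in mean square
  (\<open>gaussian_L2_approximation\<close>). Hence the standard deviation of \<open>k\<close> is close to that of \<open>\<delta>'(G)\<close>.

\<^item> Every \<open>G(f) - G(r f)\<close> is at most \<open>\<eta>\<close> with high probability, so \<open>f - r f\<close> has standard deviation at most
  \<open>2 \<eta>\<close>. By Cauchy-Schwarz, \<open>f \<mapsto> Cov\<^sub>\<mu>(f, h)\<close> then moves by at most \<open>2 \<eta>\<close> times the norm of \<open>h\<close> when it
  is composed with \<open>r\<close>; as \<open>\<delta>'\<close> sends the composition to \<open>Cov\<^sub>\<mu>(k, h)\<close>, the functional \<open>D\<close> is close in norm to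
  the covariance with \<open>k\<close>.

Together (\<open>finite_approximation\<close>) they give the equality: the covariance with \<open>k\<close> has the standard deviation of \<open>k\<close>
as its norm, and this norm is already approached on bounded scores, because these are dense
(\<open>bounded_scores_dense\<close>).

It remains to connect \<open>D\<close> with the pathwise derivative. A bounded mean-zero \<open>h\<close> is a score of its tilted path by a
first-order expansion of the square root, and it is the only one up to null sets, whatever dominating measure
is used (\<open>has_score_unique\<close>); \<open>D\<close> does not see null sets. Any pathwise derivative then agrees with \<open>D\<close> on
the bounded scores, where the efficiency bound is computed.\<close>

section \<open>Covariance and standard deviation\<close>

definition square_integrable :: "'b measure \<Rightarrow> ('b \<Rightarrow> real) \<Rightarrow> bool" where
  "square_integrable M X \<longleftrightarrow> X \<in> borel_measurable M \<and> integrable M (\<lambda>x. (X x)\<^sup>2)"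

definition sd :: "'b measure \<Rightarrow> ('b \<Rightarrow> real) \<Rightarrow> real" where
  "sd M X = sqrt (covar M X X)"

lemma square_integrable_mult:
  assumes "square_integrable M X" "square_integrable M Y"
  shows "integrable M (\<lambda>x. X x * Y x)"
proof (rule Bochner_Integration.integrable_bound)
  show "integrable M (\<lambda>x. (X x)\<^sup>2 + (Y x)\<^sup>2)"
    using assms by (auto simp: square_integrable_def)
  show "(\<lambda>x. X x * Y x) \<in> borel_measurable M"
    using assms by (auto simp: square_integrable_def)
  have "\<bar>a * b\<bar> \<le> a\<^sup>2 + b\<^sup>2" for a b :: real
  proof -
    have "2 * \<bar>a * b\<bar> \<le> a\<^sup>2 + b\<^sup>2"
      using sum_squares_bound[of "\<bar>a\<bar>" "\<bar>b\<bar>"] by (simp add: abs_mult)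
    then show ?thesis by linarith
  qed
  then show "AE x in M. norm (X x * Y x) \<le> norm ((X x)\<^sup>2 + (Y x)\<^sup>2)"
    by auto
qed

lemma square_integrable_lincomb:
  assumes "square_integrable M X" "square_integrable M Y"
  shows "square_integrable M (\<lambda>x. a * X x + b * Y x)"
proof -
  have eq: "(\<lambda>x. (a * X x + b * Y x)\<^sup>2) = (\<lambda>x. a\<^sup>2 * (X x)\<^sup>2 + (2 * a * b) * (X x * Y x) + b\<^sup>2 * (Y x)\<^sup>2)"
    by (simp add: power2_eq_square algebra_simps)
  have i: "integrable M (\<lambda>x. a\<^sup>2 * (X x)\<^sup>2 + (2 * a * b) * (X x * Y x) + b\<^sup>2 * (Y x)\<^sup>2)"
    using assms square_integrable_mult[OF assms]
    by (intro Bochner_Integration.integrable_add integrable_mult_right) (auto simp: square_integrable_def)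
  show ?thesis
    unfolding square_integrable_def eq using assms i by (auto simp: square_integrable_def)
qed

lemma square_integrable_diff:
  assumes "square_integrable M X" "square_integrable M Y"
  shows "square_integrable M (\<lambda>x. X x - Y x)"
  using square_integrable_lincomb[OF assms, of 1 "-1"] by simp

lemma square_integrable_sum:
  assumes "finite J" "\<And>j. j \<in> J \<Longrightarrow> square_integrable M (X j)"
  shows "square_integrable M (\<lambda>x. \<Sum>j\<in>J. c j * X j x)"
  using assms
proof (induction J rule: finite_induct)
  case empty
  then show ?case by (simp add: square_integrable_def)
next
  case (insert j J)
  then show ?case
    using square_integrable_lincomb[of M "X j" "\<lambda>x. \<Sum>j\<in>J. c j * X j x" "c j" 1] by simp
qed

lemma covar_commute: "covar M X Y = covar M Y X"
  by (simp add: covar_def mult.commute)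

context prob_space
begin

lemma square_integrable_integrable: "square_integrable M X \<Longrightarrow> integrable M X"
  by (auto simp: square_integrable_def intro: square_integrable_imp_integrable)

lemma square_integrable_bounded:
  assumes "X \<in> borel_measurable M" "\<And>x. \<bar>X x\<bar> \<le> B"
  shows "square_integrable M X"
proof -
  have "(X x)\<^sup>2 \<le> B\<^sup>2" for x
    using assms(2)[of x] by (metis abs_ge_zero power2_abs power_mono)
  then have "integrable M (\<lambda>x. (X x)\<^sup>2)"
    using assms(1) by (intro integrable_const_bound[where B = "B\<^sup>2"]) auto
  with assms(1) show ?thesis by (simp add: square_integrable_def)
qed

lemma covar_lincomb_left:
  assumes "square_integrable M X" "square_integrable M Y" "square_integrable M Z"
  shows "covar M (\<lambda>x. a * X x + b * Y x) Z = a * covar M X Z + b * covar M Y Z"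
proof -
  note i = assms[THEN square_integrable_integrable]
    square_integrable_mult[OF assms(1,3)] square_integrable_mult[OF assms(2,3)]
  have "expectation (\<lambda>x. (a * X x + b * Y x) * Z x) = expectation (\<lambda>x. a * (X x * Z x) + b * (Y x * Z x))"
    by (simp add: algebra_simps)
  then show ?thesis
    using i by (simp add: covar_def algebra_simps)
qed

lemma covar_diff_left:
  assumes "square_integrable M X" "square_integrable M Y" "square_integrable M Z"
  shows "covar M (\<lambda>x. X x - Y x) Z = covar M X Z - covar M Y Z"
  using covar_lincomb_left[OF assms, of 1 "-1"] by simp

lemma covar_sum_left:
  assumes "finite J" "\<And>j. j \<in> J \<Longrightarrow> square_integrable M (X j)" "square_integrable M Z"
  shows "covar M (\<lambda>x. \<Sum>j\<in>J. c j * X j x) Z = (\<Sum>j\<in>J. c j * covar M (X j) Z)"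
  using assms
proof (induction J rule: finite_induct)
  case empty
  then show ?case by (simp add: covar_def)
next
  case (insert j J)
  then show ?case
    using covar_lincomb_left[of "X j" "\<lambda>x. \<Sum>j\<in>J. c j * X j x" Z "c j" 1]
      square_integrable_sum[of J M X c] by simp
qed

lemma covar_eq_variance:
  assumes "square_integrable M X"
  shows "covar M X X = variance X"
  using assms square_integrable_integrable[OF assms]
  by (subst variance_eq) (auto simp: square_integrable_def covar_def power2_eq_square)

lemma covar_nonneg: "square_integrable M X \<Longrightarrow> 0 \<le> covar M X X"
  by (simp add: covar_eq_variance)

lemma sd_nonneg: "square_integrable M X \<Longrightarrow> 0 \<le> sd M X"
  by (simp add: sd_def covar_nonneg)

lemma sd_power2: "square_integrable M X \<Longrightarrow> (sd M X)\<^sup>2 = covar M X X"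
  by (simp add: sd_def covar_nonneg)

lemma covar_le_second_moment: "covar M X X \<le> expectation (\<lambda>x. (X x)\<^sup>2)"
  by (simp add: covar_def power2_eq_square)

lemma sd_le_second_moment:
  assumes "expectation (\<lambda>x. (X x)\<^sup>2) \<le> B\<^sup>2" "0 \<le> B"
  shows "sd M X \<le> B"
  unfolding sd_def using covar_le_second_moment[of X] assms by (intro real_le_lsqrt) auto

lemma covar_diff_self:
  assumes X: "square_integrable M X" and Y: "square_integrable M Y"
  shows "covar M (\<lambda>x. X x - a * Y x) (\<lambda>x. X x - a * Y x) =
    covar M X X - 2 * a * covar M X Y + a\<^sup>2 * covar M Y Y"
proof -
  let ?Z = "\<lambda>x. 1 * X x + (- a) * Y x"
  have Z: "square_integrable M ?Z"
    by (rule square_integrable_lincomb) fact+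
  have 1: "covar M ?Z ?Z = 1 * covar M X ?Z + (- a) * covar M Y ?Z"
    by (rule covar_lincomb_left) fact+
  have 2: "covar M X ?Z = 1 * covar M X X + (- a) * covar M X Y"
    using covar_lincomb_left[OF X Y X, of 1 "- a"] covar_commute[of M X] by metis
  have 3: "covar M Y ?Z = 1 * covar M X Y + (- a) * covar M Y Y"
    using covar_lincomb_left[OF X Y Y, of 1 "- a"] covar_commute[of M Y] by metis
  have "covar M ?Z ?Z = covar M X X - 2 * a * covar M X Y + a\<^sup>2 * covar M Y Y"
    unfolding 1 2 3 by (simp add: algebra_simps power2_eq_square)
  then show ?thesis by simp
qed

lemma covar_Cauchy_Schwarz:
  assumes X: "square_integrable M X" and Y: "square_integrable M Y"
  shows "\<bar>covar M X Y\<bar> \<le> sd M X * sd M Y"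
proof -
  have nn: "0 \<le> covar M X X - 2 * a * covar M X Y + a\<^sup>2 * covar M Y Y" for a
    using covar_nonneg[OF square_integrable_lincomb[OF X Y, of 1 "- a"]]
      covar_diff_self[OF X Y, of a] by simp
  have "(covar M X Y)\<^sup>2 \<le> covar M X X * covar M Y Y"
  proof (cases "covar M Y Y = 0")
    case True
    have "covar M X Y = 0"
    proof (rule ccontr)
      assume "covar M X Y \<noteq> 0"
      then show False
        using nn[of "(covar M X X + 1) / (2 * covar M X Y)"] True by (simp add: field_simps)
    qed
    then show ?thesis using True by simp
  next
    case False
    then have p: "covar M Y Y > 0" using covar_nonneg[OF Y] by simp
    have "0 \<le> covar M Y Y * (covar M X X - 2 * (covar M X Y / covar M Y Y) * covar M X Y
        + (covar M X Y / covar M Y Y)\<^sup>2 * covar M Y Y)"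
      by (rule mult_nonneg_nonneg[OF less_imp_le[OF p] nn])
    also have "\<dots> = covar M X X * covar M Y Y - (covar M X Y)\<^sup>2"
      using p by (simp add: field_simps power2_eq_square)
    finally show ?thesis by simp
  qed
  then have "sqrt ((covar M X Y)\<^sup>2) \<le> sqrt (covar M X X * covar M Y Y)"
    by (rule real_sqrt_le_mono)
  then show ?thesis by (simp add: sd_def real_sqrt_mult)
qed

lemma sd_triangle:
  assumes X: "square_integrable M X" and Y: "square_integrable M Y"
  shows "sd M X \<le> sd M (\<lambda>x. X x - Y x) + sd M Y"
proof -
  let ?Z = "\<lambda>x. X x - Y x"
  have Z: "square_integrable M ?Z" by (rule square_integrable_diff) fact+
  have "(sd M X)\<^sup>2 = covar M ?Z X + covar M Y X"
    using covar_diff_left[OF X Y X] sd_power2[OF X] by simp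
  also have "\<dots> \<le> sd M ?Z * sd M X + sd M Y * sd M X"
    using covar_Cauchy_Schwarz[OF Z X] covar_Cauchy_Schwarz[OF Y X] by linarith
  finally have "sd M X * sd M X \<le> (sd M ?Z + sd M Y) * sd M X"
    by (simp add: power2_eq_square algebra_simps)
  then show ?thesis
    using sd_nonneg[OF X] sd_nonneg[OF Y] sd_nonneg[OF Z]
    by (cases "sd M X = 0") (auto simp: mult_le_cancel_right)
qed

lemma sd_minus_commute:
  "sd M (\<lambda>x. X x - Y x) = sd M (\<lambda>x. Y x - X x)"
proof -
  have "expectation (\<lambda>x. Y x - X x) = - expectation (\<lambda>x. X x - Y x)"
    by (simp flip: Bochner_Integration.integral_minus)
  moreover have "(Y x - X x) * (Y x - X x) = (X x - Y x) * (X x - Y x)" for x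
    by (simp add: algebra_simps)
  ultimately show ?thesis
    by (simp add: sd_def covar_def)
qed

lemma sd_diff_le:
  assumes X: "square_integrable M X" and Y: "square_integrable M Y"
  shows "\<bar>sd M X - sd M Y\<bar> \<le> sd M (\<lambda>x. X x - Y x)"
  using sd_triangle[OF X Y] sd_triangle[OF Y X] sd_minus_commute[of X Y] by linarith

end

section \<open>Gaussian variables: from probability to mean square\<close>

lemma (in prob_space) prob_outside:
  fixes X :: "'a \<Rightarrow> real"
  assumes A: "A \<in> sets M" "1 - p \<le> prob A" and X: "X \<in> borel_measurable M"
    and le: "\<And>\<omega>. \<omega> \<in> A \<Longrightarrow> \<bar>X \<omega>\<bar> \<le> e"
  shows "prob {\<omega> \<in> space M. \<bar>X \<omega>\<bar> > e} \<le> p"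
proof -
  have "{\<omega> \<in> space M. \<bar>X \<omega>\<bar> > e} \<subseteq> space M - A"
  proof
    fix \<omega> assume \<omega>: "\<omega> \<in> {\<omega> \<in> space M. \<bar>X \<omega>\<bar> > e}"
    then have "\<omega> \<notin> A" using le[of \<omega>] by auto
    with \<omega> show "\<omega> \<in> space M - A" by simp
  qed
  then have "prob {\<omega> \<in> space M. \<bar>X \<omega>\<bar> > e} \<le> prob (space M - A)"
    using A by (intro finite_measure_mono) auto
  also have "\<dots> = 1 - prob A" using A by (simp add: prob_compl)
  finally show ?thesis using A by simp
qed

lemma (in prob_space) gaussian_rv_square_integrable:
  assumes "gaussian_rv M X"
  shows "square_integrable M X"
proof -
  from assms obtain m s where X[measurable]: "X \<in> borel_measurable M" and s: "0 \<le> s"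
    and d: "distr M borel X =
      (if s = 0 then return borel m else density lborel (\<lambda>x. ennreal (normal_density m s x)))"
    unfolding gaussian_rv_def by blast
  have "integrable (distr M borel X) (\<lambda>x. x\<^sup>2)"
  proof (cases "s = 0")
    case True
    then show ?thesis unfolding d by (simp add: integrable_iff_bounded nn_integral_return)
  next
    case False
    with s have s: "0 < s" by simp
    have "(\<lambda>x. normal_density m s x * x\<^sup>2) = (\<lambda>x. normal_density m s x * (x - m)^2
        + 2 * m * (normal_density m s x * x) - m\<^sup>2 * normal_density m s x)"
      by (auto simp: power2_eq_square algebra_simps)
    moreover have "integrable lborel \<dots>"
      using integrable_normal_moment[OF s, of m 2] integrable_normal_moment_nz_1[OF s, of m]
        integrable_normal_density[OF s, of m]
      by (intro Bochner_Integration.integrable_add Bochner_Integration.integrable_diff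
          integrable_mult_right) auto
    ultimately show ?thesis
      using False unfolding d by (simp add: integrable_density)
  qed
  then show ?thesis
    by (simp add: square_integrable_def integrable_distr_eq)
qed

text \<open>A normal density with standard deviation \<open>s\<close> is at most \<open>1 / (2 s)\<close>, so the interval \<open>[-a, a]\<close> carries mass at
most \<open>a / s\<close>; if that mass is at least \<open>1/2\<close>, then \<open>s \<le> 2 a\<close>.\<close>

lemma (in prob_space) gaussian_small_ball:
  assumes g: "gaussian_rv M X" and mean: "expectation X = 0" and a: "0 \<le> a"
    and P: "prob {x \<in> space M. \<bar>X x\<bar> > a} \<le> 1 / 2"
  shows "expectation (\<lambda>x. (X x)\<^sup>2) \<le> (2 * a)\<^sup>2"
proof -
  from g obtain m s where X[measurable]: "X \<in> borel_measurable M" and s: "0 \<le> s"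
    and d: "distr M borel X =
      (if s = 0 then return borel m else density lborel (\<lambda>x. ennreal (normal_density m s x)))"
    unfolding gaussian_rv_def by blast
  have E1: "expectation X = (\<integral>x. x \<partial>distr M borel X)"
    and E2: "expectation (\<lambda>x. (X x)\<^sup>2) = (\<integral>x. x\<^sup>2 \<partial>distr M borel X)"
    by (simp_all add: integral_distr)
  show ?thesis
  proof (cases "s = 0")
    case True
    then show ?thesis using E1 E2 mean unfolding d by (simp add: integral_return)
  next
    case False
    with s have s: "0 < s" by simp
    have D: "distributed M lborel X (\<lambda>x. ennreal (normal_density m s x))"
      using False d by (auto simp: distributed_def cong: distr_cong)
    have m: "m = 0" using normal_distributed_expectation[OF s D] mean by simp
    have E2: "expectation (\<lambda>x. (X x)\<^sup>2) = s\<^sup>2"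
      using normal_distributed_variance[OF s D] mean by simp
    have bd: "normal_density m s x \<le> 1 / (2 * s)" for x
    proof -
      have "2 \<le> sqrt (2 * pi)"
        using pi_gt3 by (intro real_le_rsqrt) auto
      then have "2 * s \<le> sqrt (2 * pi) * s"
        using s by simp
      moreover have "sqrt (2 * pi * s\<^sup>2) = sqrt (2 * pi) * s"
        using s by (simp add: real_sqrt_mult)
      ultimately have "1 / sqrt (2 * pi * s\<^sup>2) \<le> 1 / (2 * s)"
        using s by (simp add: frac_le)
      moreover have "exp (- (x - m)\<^sup>2 / (2 * s\<^sup>2)) \<le> 1"
        by simp
      ultimately have "1 / sqrt (2 * pi * s\<^sup>2) * exp (- (x - m)\<^sup>2 / (2 * s\<^sup>2)) \<le> 1 / (2 * s) * 1"
        using s by (intro mult_mono) auto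
      then show ?thesis by (simp add: normal_density_def)
    qed
    have "emeasure M {x \<in> space M. \<bar>X x\<bar> \<le> a} = emeasure (distr M lborel X) {- a..a}"
      by (subst emeasure_distr) (auto intro!: arg_cong[where f = "emeasure M"])
    also have "\<dots> = (\<integral>\<^sup>+x. ennreal (normal_density m s x) * indicator {- a..a} x \<partial>lborel)"
      using D by (simp add: distributed_def emeasure_density)
    also have "\<dots> \<le> (\<integral>\<^sup>+x. ennreal (1 / (2 * s)) * indicator {- a..a} x \<partial>lborel)"
      using bd by (intro nn_integral_mono mult_right_mono ennreal_leI) auto
    also have "\<dots> = ennreal (1 / (2 * s)) * ennreal (2 * a)"
      using a by (simp add: nn_integral_cmult_indicator)
    also have "\<dots> = ennreal (a / s)"
      using a s by (simp flip: ennreal_mult)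
    finally have "prob {x \<in> space M. \<bar>X x\<bar> \<le> a} \<le> a / s"
      using a s by (simp add: emeasure_eq_measure)
    moreover have "prob {x \<in> space M. \<bar>X x\<bar> \<le> a} = 1 - prob {x \<in> space M. \<bar>X x\<bar> > a}"
      by (subst prob_neg[symmetric]) (auto simp: not_less)
    ultimately have "1 / 2 \<le> a / s" using P by linarith
    then have "s \<le> 2 * a" using s by (simp add: field_simps)
    then show ?thesis unfolding E2 using s by (intro power_mono) auto
  qed
qed

text \<open>Closeness in probability becomes closeness in mean square. For \<open>Z \<in> S\<close> still closer to \<open>X\<close> than \<open>Y\<close> is,
\<open>Z - Y\<close> is a centred normal variable exceeding \<open>2 e\<close> with probability at most \<open>1/2\<close>, whence \<open>gaussian_small_ball\<close>
bounds its second moment by \<open>(4 e)\<^sup>2\<close>. Along a sequence of such \<open>Z\<close> with summable errors, Borel-Cantelli gives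
almost sure convergence to \<open>X\<close>, and Fatou's lemma carries the bound over to \<open>X - Y\<close>.\<close>

lemma (in prob_space) gaussian_L2_approximation:
  assumes X[measurable]: "X \<in> borel_measurable M"
    and S: "\<And>Y Y'. Y \<in> S \<Longrightarrow> Y' \<in> S \<Longrightarrow>
      gaussian_rv M (\<lambda>x. Y x - Y' x) \<and> expectation (\<lambda>x. Y x - Y' x) = 0"
    and S_meas: "\<And>Y. Y \<in> S \<Longrightarrow> Y \<in> borel_measurable M"
    and dense: "\<And>e. 0 < e \<Longrightarrow> \<exists>Y\<in>S. prob {x \<in> space M. \<bar>X x - Y x\<bar> > e} \<le> e"
    and Y: "Y \<in> S" and e: "0 < e"
    and P: "prob {x \<in> space M. \<bar>X x - Y x\<bar> > e} \<le> 1 / 4"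
  shows "integrable M (\<lambda>x. (X x - Y x)\<^sup>2)"
    and "expectation (\<lambda>x. (X x - Y x)\<^sup>2) \<le> (4 * e)\<^sup>2"
proof -
  \<comment> \<open>At most \<open>1/4\<close>, so that with the failure probability of \<open>Y\<close> it amounts to at most \<open>1/2\<close>; geometric decay makes
    it summable.\<close>
  define \<epsilon> where "\<epsilon> n = min e (1 / 4) * (1 / 2) ^ n" for n :: nat
  have \<epsilon>: "0 < \<epsilon> n" "\<epsilon> n \<le> e" "\<epsilon> n \<le> 1 / 4" for n
  proof -
    have "min e (1 / 4) * (1 / 2) ^ n \<le> min e (1 / 4) * 1"
      using e by (intro mult_left_mono power_le_one) auto
    then show "0 < \<epsilon> n" "\<epsilon> n \<le> e" "\<epsilon> n \<le> 1 / 4"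
      using e unfolding \<epsilon>_def by auto
  qed
  have \<epsilon>_sum: "summable \<epsilon>"
    unfolding \<epsilon>_def by (intro summable_mult summable_geometric) auto
  have "\<forall>n. \<exists>Z. Z \<in> S \<and> prob {x \<in> space M. \<bar>X x - Z x\<bar> > \<epsilon> n} \<le> \<epsilon> n"
    using dense[OF \<epsilon>(1)] by blast
  from choice[OF this] obtain Z where ZS: "\<And>n. Z n \<in> S"
    and Z: "\<And>n. prob {x \<in> space M. \<bar>X x - Z n x\<bar> > \<epsilon> n} \<le> \<epsilon> n"
    by blast
  have [measurable]: "Z n \<in> borel_measurable M" "Y \<in> borel_measurable M" for n
    using ZS Y S_meas by auto
  have near: "expectation (\<lambda>x. (Z n x - Y x)\<^sup>2) \<le> (4 * e)\<^sup>2" for n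
  proof -
    have "prob {x \<in> space M. \<bar>Z n x - Y x\<bar> > 2 * e} \<le>
        prob ({x \<in> space M. \<bar>X x - Z n x\<bar> > \<epsilon> n} \<union> {x \<in> space M. \<bar>X x - Y x\<bar> > e})"
      using \<epsilon>(2)[of n] by (intro finite_measure_mono) auto
    also have "\<dots> \<le> prob {x \<in> space M. \<bar>X x - Z n x\<bar> > \<epsilon> n} + prob {x \<in> space M. \<bar>X x - Y x\<bar> > e}"
      by (intro measure_Un_le) auto
    also have "\<dots> \<le> 1 / 2"
      using Z[of n] \<epsilon>(3)[of n] P by linarith
    finally have "expectation (\<lambda>x. (Z n x - Y x)\<^sup>2) \<le> (2 * (2 * e))\<^sup>2"
      using S[OF ZS[of n] Y] e by (intro gaussian_small_ball) auto
    then show ?thesis by simp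
  qed
  have near': "(\<integral>\<^sup>+x. ennreal ((Z n x - Y x)\<^sup>2) \<partial>M) \<le> ennreal ((4 * e)\<^sup>2)" for n
    using near[of n] gaussian_rv_square_integrable[of "\<lambda>x. Z n x - Y x"] S[OF ZS[of n] Y]
    by (subst nn_integral_eq_integral) (auto simp: square_integrable_def)
  have "AE x in M. eventually (\<lambda>n. x \<in> space M - {x \<in> space M. \<bar>X x - Z n x\<bar> > \<epsilon> n}) sequentially"
    by (rule borel_cantelli_AE1)
      (auto simp: less_top[symmetric] intro!: summable_comparison_test[OF _ \<epsilon>_sum] exI[of _ 0] Z)
  then have lim: "AE x in M. (\<lambda>n. Z n x) \<longlonglongrightarrow> X x"
  proof (eventually_elim)
    case (elim x)
    show ?case
    proof (rule Lim_transform_bound[THEN LIM_zero_cancel[where l = "X x"]])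
      show "\<forall>\<^sub>F n in sequentially. norm (Z n x - X x) \<le> norm (\<epsilon> n)"
        using elim by eventually_elim (use \<epsilon>(1) in \<open>auto simp: abs_minus_commute less_imp_le not_less\<close>)
      show "\<epsilon> \<longlonglongrightarrow> 0" using \<epsilon>_sum by (rule summable_LIMSEQ_zero)
    qed
  qed
  have "(\<integral>\<^sup>+x. ennreal ((X x - Y x)\<^sup>2) \<partial>M) =
      (\<integral>\<^sup>+x. liminf (\<lambda>n. ennreal ((Z n x - Y x)\<^sup>2)) \<partial>M)"
  proof (rule nn_integral_cong_AE, use lim in eventually_elim)
    case (elim x)
    then have "(\<lambda>n. ennreal ((Z n x - Y x)\<^sup>2)) \<longlonglongrightarrow> ennreal ((X x - Y x)\<^sup>2)"
      by (intro tendsto_intros)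
    then show ?case
      by (intro lim_imp_Liminf[symmetric]) auto
  qed
  also have "\<dots> \<le> liminf (\<lambda>n. \<integral>\<^sup>+x. ennreal ((Z n x - Y x)\<^sup>2) \<partial>M)"
    by (rule nn_integral_liminf) auto
  also have "\<dots> \<le> limsup (\<lambda>n. \<integral>\<^sup>+x. ennreal ((Z n x - Y x)\<^sup>2) \<partial>M)"
    by (rule Liminf_le_Limsup) auto
  also have "\<dots> \<le> ennreal ((4 * e)\<^sup>2)"
    using near' by (intro Limsup_bounded always_eventually allI) auto
  finally have le: "(\<integral>\<^sup>+x. ennreal ((X x - Y x)\<^sup>2) \<partial>M) \<le> ennreal ((4 * e)\<^sup>2)" .
  show i: "integrable M (\<lambda>x. (X x - Y x)\<^sup>2)"
    using le_less_trans[OF le] by (intro integrableI_nonneg) auto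
  show "expectation (\<lambda>x. (X x - Y x)\<^sup>2) \<le> (4 * e)\<^sup>2"
    using le by (subst (asm) nn_integral_eq_integral[OF i]) auto
qed

section \<open>Bounded functions on a class and continuous linear functionals\<close>

lemma mspace_linf:
  "z \<in> mspace (linf \<F>) \<longleftrightarrow> z \<in> extensional \<F> \<and> (\<exists>B. \<forall>f\<in>\<F>. \<bar>z f\<bar> \<le> B)"
proof -
  have "Metric_space.mbounded UNIV dist (z ` \<F>) \<longleftrightarrow> (\<exists>B. \<forall>f\<in>\<F>. \<bar>z f\<bar> \<le> B)"
    by (simp add: bounded_iff)
  then show ?thesis
    by (simp add: linf_def Met_TC.fspace_def)
qed

lemma restrict_in_linf: "(\<And>f. f \<in> \<F> \<Longrightarrow> \<bar>z f\<bar> \<le> B) \<Longrightarrow> restrict z \<F> \<in> mspace (linf \<F>)"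
  unfolding mspace_linf by auto

lemma mdist_linf_le:
  assumes "z \<in> mspace (linf \<F>)" "w \<in> mspace (linf \<F>)" "0 \<le> a"
    and "\<And>f. f \<in> \<F> \<Longrightarrow> \<bar>z f - w f\<bar> \<le> a"
  shows "mdist (linf \<F>) z w \<le> a"
proof (cases "\<F> = {}")
  case True
  with assms have "z = w" by (auto simp: mspace_linf)
  moreover have "mdist (linf \<F>) z z = 0"
    by (rule Metric_space.zero[THEN iffD2, OF Metric_space_mspace_mdist assms(1) assms(1) refl])
  ultimately show ?thesis using assms(3) by (simp only:)
next
  case False
  with assms show ?thesis
    unfolding linf_def by (subst funspace_mdist_le) (auto simp: dist_real_def)
qed

lemma linf_le_mdist:
  assumes "z \<in> mspace (linf \<F>)" "w \<in> mspace (linf \<F>)" "f \<in> \<F>"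
  shows "\<bar>z f - w f\<bar> \<le> mdist (linf \<F>) z w"
  using funspace_mdist_le[of z \<F> euclidean_metric w "mdist (linf \<F>) z w"] assms
  unfolding linf_def by (auto simp: dist_real_def)

context
  fixes \<F> :: "('a \<Rightarrow> real) set" and L :: "(('a \<Rightarrow> real) \<Rightarrow> real) \<Rightarrow> real"
  assumes L: "continuous_linear_linf \<F> L"
begin

lemma linf_lincomb:
  assumes "z \<in> mspace (linf \<F>)" "w \<in> mspace (linf \<F>)"
  shows "L (restrict (\<lambda>f. a * z f + b * w f) \<F>) = a * L z + b * L w"
  using L assms unfolding continuous_linear_linf_def by blast

lemma linf_diff:
  assumes "z \<in> mspace (linf \<F>)" "w \<in> mspace (linf \<F>)"
  shows "L (restrict (\<lambda>f. z f - w f) \<F>) = L z - L w"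
  using linf_lincomb[OF assms, of 1 "-1"] by simp

lemma linf_zero: "L (restrict (\<lambda>f. 0) \<F>) = 0"
  using linf_lincomb[OF restrict_in_linf restrict_in_linf, of "\<lambda>f. 0" 0 "\<lambda>f. 0" 0 0 0] by simp

lemma linf_sum:
  assumes "finite J" "\<And>j. j \<in> J \<Longrightarrow> z j \<in> mspace (linf \<F>)"
  shows "restrict (\<lambda>f. \<Sum>j\<in>J. c j * z j f) \<F> \<in> mspace (linf \<F>) \<and>
    L (restrict (\<lambda>f. \<Sum>j\<in>J. c j * z j f) \<F>) = (\<Sum>j\<in>J. c j * L (z j))"
  using assms
proof (induction J rule: finite_induct)
  case empty
  have "restrict (\<lambda>f. 0) \<F> \<in> mspace (linf \<F>)"
    by (rule restrict_in_linf[where B = 0]) simp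
  then show ?case using linf_zero by (simp only: sum.empty)
next
  case (insert j J)
  let ?w = "restrict (\<lambda>f. \<Sum>j\<in>J. c j * z j f) \<F>"
  have j: "z j \<in> mspace (linf \<F>)"
    using insert.prems by blast
  have w: "?w \<in> mspace (linf \<F>)" and Lw: "L ?w = (\<Sum>j\<in>J. c j * L (z j))"
    using insert.IH insert.prems by blast+
  have eq: "restrict (\<lambda>f. \<Sum>j\<in>insert j J. c j * z j f) \<F> = restrict (\<lambda>f. c j * z j f + 1 * ?w f) \<F>"
    using insert.hyps by (intro restrict_ext) simp
  obtain A B where A: "\<And>f. f \<in> \<F> \<Longrightarrow> \<bar>z j f\<bar> \<le> A" and B: "\<And>f. f \<in> \<F> \<Longrightarrow> \<bar>?w f\<bar> \<le> B"
    using j w unfolding mspace_linf by blast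
  have sum: "restrict (\<lambda>f. c j * z j f + 1 * ?w f) \<F> \<in> mspace (linf \<F>)"
  proof (rule restrict_in_linf[where B = "\<bar>c j\<bar> * A + B"])
    fix f assume f: "f \<in> \<F>"
    have "\<bar>c j * z j f\<bar> \<le> \<bar>c j\<bar> * A"
      using A[OF f] by (simp add: abs_mult mult_left_mono)
    then show "\<bar>c j * z j f + 1 * ?w f\<bar> \<le> \<bar>c j\<bar> * A + B"
      using B[OF f] by linarith
  qed
  show ?case
    unfolding eq linf_lincomb[OF j w] Lw using insert.hyps sum by (simp only: sum.insert mult_1 simp_thms)
qed

text \<open>Continuity at \<open>0\<close> provides a ball of some radius \<open>d\<close> that \<open>L\<close> maps into \<open>[-1, 1]\<close>; scaling \<open>z\<close> into it gives the bound.\<close>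

lemma linf_operator_bound:
  "\<exists>C>0. \<forall>z\<in>mspace (linf \<F>). \<forall>B. (\<forall>f\<in>\<F>. \<bar>z f\<bar> \<le> B) \<and> 0 \<le> B \<longrightarrow> \<bar>L z\<bar> \<le> C * B"
proof -
  let ?o = "restrict (\<lambda>f. 0) \<F> :: ('a \<Rightarrow> real) \<Rightarrow> real"
  have o: "?o \<in> mspace (linf \<F>)" by (rule restrict_in_linf[where B = 0]) simp
  interpret Metric_space "mspace (linf \<F>)" "mdist (linf \<F>)"
    by (rule Metric_space_mspace_mdist)
  have "continuous_map mtopology euclidean L"
    using L by (simp add: continuous_linear_linf_def mtopology_of_def)
  then have "continuous_map mtopology (Metric_space.mtopology UNIV dist) L"
    by simp
  then obtain d where d: "d > 0"
    "\<And>x. x \<in> mspace (linf \<F>) \<Longrightarrow> mdist (linf \<F>) ?o x < d \<Longrightarrow> dist (L ?o) (L x) < 1"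
    using o unfolding metric_continuous_map[OF Met_TC.Metric_space_axioms] by (meson zero_less_one)
  show ?thesis
  proof (intro exI[of _ "2 / d"] conjI ballI allI impI)
    show "0 < 2 / d" using d by simp
    fix z B assume z: "z \<in> mspace (linf \<F>)" and B: "(\<forall>f\<in>\<F>. \<bar>z f\<bar> \<le> B) \<and> 0 \<le> B"
    have small: "t * \<bar>L z\<bar> \<le> 1" if t: "0 \<le> t" "t * B < d" for t
    proof -
      let ?w = "restrict (\<lambda>f. t * z f + 0 * z f) \<F>"
      have le: "\<bar>t * z f\<bar> \<le> t * B" if "f \<in> \<F>" for f
        using that B t by (simp add: abs_mult mult_left_mono)
      have w: "?w \<in> mspace (linf \<F>)"
        by (rule restrict_in_linf[where B = "t * B"]) (use le in auto)
      have "mdist (linf \<F>) ?o ?w \<le> t * B"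
        using o w t B by (rule_tac mdist_linf_le) (auto simp: le)
      with t d(2)[OF w] have "\<bar>L ?w\<bar> < 1" by (simp add: dist_real_def linf_zero)
      then show ?thesis
        using t unfolding linf_lincomb[OF z z] by (simp add: abs_mult)
    qed
    show "\<bar>L z\<bar> \<le> 2 / d * B"
    proof (cases "B = 0")
      case True
      show ?thesis
      proof (rule ccontr)
        assume "\<not> ?thesis"
        then have "\<bar>L z\<bar> > 0" using True by simp
        then show False using small[of "2 / \<bar>L z\<bar>"] True d by simp
      qed
    next
      case False
      with B have "B > 0" by simp
      then show ?thesis using small[of "d / (2 * B)"] d by (simp add: field_simps)
    qed
  qed
qed

text \<open>Composition with a map of finite range turns \<open>z\<close> into a finite combination of indicators of the fibres of \<open>r\<close>,
with values of \<open>z\<close> as coefficients.\<close>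

lemma linf_step_function:
  assumes r: "r \<in> \<F> \<rightarrow> \<F>" "finite (r ` \<F>)"
  shows "L (restrict (\<lambda>f. z (r f)) \<F>) =
    (\<Sum>g\<in>r ` \<F>. L (restrict (\<lambda>f. if r f = g then 1 else 0) \<F>) * z g)"
proof -
  let ?e = "\<lambda>g. restrict (\<lambda>f. if r f = g then 1 else 0) \<F> :: ('a \<Rightarrow> real) \<Rightarrow> real"
  have e: "?e g \<in> mspace (linf \<F>)" for g
    by (rule restrict_in_linf[where B = 1]) auto
  have "restrict (\<lambda>f. z (r f)) \<F> = restrict (\<lambda>f. \<Sum>g\<in>r ` \<F>. z g * ?e g f) \<F>"
  proof (rule restrict_ext)
    fix f assume f: "f \<in> \<F>"
    then have "(\<Sum>g\<in>r ` \<F>. z g * ?e g f) = (\<Sum>g\<in>r ` \<F>. if g = r f then z (r f) else 0)"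
      by (intro sum.cong) auto
    also have "\<dots> = z (r f)" using f r(2) by simp
    finally show "z (r f) = (\<Sum>g\<in>r ` \<F>. z g * ?e g f)" by simp
  qed
  then show ?thesis
    using linf_sum[of "r ` \<F>" ?e z] r(2) e by (simp add: mult.commute)
qed

end

text \<open>A finite net \<open>Z\<close> of \<open>K\<close> consists of bounded functions, so rounding the vector \<open>(z f)\<^sub>z\<^sub>\<in>\<^sub>Z\<close> to a grid sorts the
elements \<open>f\<close> of the class into finitely many cells; \<open>r\<close> picks one element from each cell. The map \<open>r\<close> serves all
members of \<open>K\<close> at once.\<close>

lemma compact_linf_step_approximation:
  assumes K: "compactin (mtopology_of (linf \<F>)) K" and e: "0 < e"
  shows "\<exists>r. r \<in> \<F> \<rightarrow> \<F> \<and> finite (r ` \<F>) \<and> (\<forall>z\<in>K. \<forall>f\<in>\<F>. \<bar>z f - z (r f)\<bar> \<le> e)"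
proof -
  interpret Metric_space "mspace (linf \<F>)" "mdist (linf \<F>)"
    by (rule Metric_space_mspace_mdist)
  define d where "d = e / 3"
  have d: "0 < d" using e by (simp add: d_def)
  have "mtotally_bounded K"
    using K by (intro compactin_imp_mtotally_bounded) (simp add: mtopology_of_def)
  then obtain Z where Z: "finite Z" "Z \<subseteq> K" "K \<subseteq> (\<Union>x\<in>Z. mball x d)"
    using d unfolding mtotally_bounded_def by meson
  have KM: "K \<subseteq> mspace (linf \<F>)"
    using compactin_subset_topspace[OF K] by simp
  have "\<exists>B. \<forall>f\<in>\<F>. \<bar>z f\<bar> \<le> B" if "z \<in> Z" for z
    using that Z KM mspace_linf[of z \<F>] by blast
  then obtain B where B: "\<And>z f. z \<in> Z \<Longrightarrow> f \<in> \<F> \<Longrightarrow> \<bar>z f\<bar> \<le> B z"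
    by metis
  define \<phi> where "\<phi> f = restrict (\<lambda>z. \<lfloor>z f / d\<rfloor>) Z" for f
  have "\<phi> ` \<F> \<subseteq> (\<Pi>\<^sub>E z\<in>Z. {\<lfloor>- B z / d\<rfloor>..\<lfloor>B z / d\<rfloor>})"
  proof (clarify, rule PiE_I)
    fix f z assume "f \<in> \<F>" "z \<in> Z"
    then have "- B z \<le> z f" "z f \<le> B z"
      using B[of z f] by auto
    then have "(- B z) / d \<le> z f / d" "z f / d \<le> B z / d"
      using d by (auto intro!: divide_right_mono simp only: less_imp_le)
    then show "\<phi> f z \<in> {\<lfloor>- B z / d\<rfloor>..\<lfloor>B z / d\<rfloor>}"
      using \<open>z \<in> Z\<close> by (auto simp: \<phi>_def intro!: floor_mono)
  qed (simp add: \<phi>_def)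
  then have fin: "finite (\<phi> ` \<F>)"
    by (rule finite_subset) (intro finite_PiE Z(1) finite_atLeastAtMost_int)
  define r where "r f = (SOME g. g \<in> \<F> \<and> \<phi> g = \<phi> f)" for f
  have r: "r f \<in> \<F> \<and> \<phi> (r f) = \<phi> f" if "f \<in> \<F>" for f
    unfolding r_def by (rule someI[of _ f]) (use that in simp)
  have "r ` \<F> = (\<lambda>p. SOME g. g \<in> \<F> \<and> \<phi> g = p) ` \<phi> ` \<F>"
    by (auto simp: r_def)
  with fin have "finite (r ` \<F>)" by simp
  moreover have "\<bar>z f - z (r f)\<bar> \<le> e" if z: "z \<in> K" and f: "f \<in> \<F>" for z f
  proof -
    obtain w where w: "w \<in> Z" "z \<in> mball w d" using Z z by blast
    have wz: "\<bar>w g - z g\<bar> \<le> d" if "g \<in> \<F>" for g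
      using linf_le_mdist[of w \<F> z g] w(2) that by (auto simp: in_mball)
    have "\<phi> (r f) w = \<phi> f w" using r[OF f] by simp
    then have "\<lfloor>w f / d\<rfloor> = \<lfloor>w (r f) / d\<rfloor>"
      unfolding \<phi>_def using w(1) by simp
    then have "\<bar>w f / d - w (r f) / d\<bar> < 1" by linarith
    then have "\<bar>w f - w (r f)\<bar> \<le> d"
      using d by (simp add: abs_if field_simps split: if_splits)
    with wz[OF f] wz[of "r f"] r[OF f] show ?thesis unfolding d_def by linarith
  qed
  ultimately show ?thesis
    using r by (intro exI[of _ r]) auto
qed

section \<open>Bounded scores\<close>

locale borel_prob_space =
  fixes \<mu> :: "'a::topological_space measure"
  assumes prob_\<mu>: "prob_space \<mu>" and sets_\<mu>: "sets \<mu> = sets borel"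
begin

sublocale \<mu>: prob_space \<mu> by (rule prob_\<mu>)

lemma measurable_\<mu>: "h \<in> borel_measurable borel \<longleftrightarrow> h \<in> borel_measurable \<mu>"
  using measurable_cong_sets[OF sets_\<mu> refl] by blast

lemma l2_iff: "h \<in> l2 \<mu> \<longleftrightarrow> square_integrable \<mu> h"
  by (simp add: l2_def square_integrable_def measurable_\<mu>)

lemma bounded_scores_square_integrable:
  assumes "h \<in> bounded_scores \<mu>"
  shows "square_integrable \<mu> h"
proof -
  obtain B where "\<And>x. \<bar>h x\<bar> \<le> B"
    using assms by (auto simp: bounded_scores_def bounded_iff)
  then show ?thesis
    using assms by (intro \<mu>.square_integrable_bounded) (auto simp: bounded_scores_def measurable_\<mu>)
qed

text \<open>The third property keeps the density \<open>1 + t g\<close> of a tilted measure away from \<open>0\<close>, so that no truncation takes place.\<close>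

lemma bounded_score_bound:
  assumes "g \<in> bounded_scores \<mu>"
  obtains B where "0 < B" "\<And>x. \<bar>g x\<bar> \<le> B"
    "\<And>t x. 0 \<le> t \<Longrightarrow> t * B \<le> 1 / 2 \<Longrightarrow> 1 / 2 \<le> 1 + t * g x"
proof -
  obtain B where B: "0 < B" "\<And>x. \<bar>g x\<bar> \<le> B"
    using assms by (auto simp: bounded_scores_def bounded_pos)
  have "1 / 2 \<le> 1 + t * g x" if "0 \<le> t" "t * B \<le> 1 / 2" for t x
  proof -
    have "\<bar>t * g x\<bar> \<le> t * B" using B(2)[of x] that(1) by (simp add: abs_mult mult_left_mono)
    then show ?thesis using that(2) by linarith
  qed
  with B that show ?thesis by blast
qed

lemma sd_bounded_score: "h \<in> bounded_scores \<mu> \<Longrightarrow> sd \<mu> h = l2_norm \<mu> h"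
  by (simp add: sd_def l2_norm_def covar_def bounded_scores_def power2_eq_square)

text \<open>Truncation converges in mean square by dominated convergence, and recentring does not change the standard
deviation of the error.\<close>

lemma bounded_scores_dense:
  assumes k: "square_integrable \<mu> k" and e: "0 < e"
  shows "\<exists>h\<in>bounded_scores \<mu>. sd \<mu> (\<lambda>x. k x - h x) \<le> e"
proof -
  define T where "T n x = max (- real n) (min (real n) (k x))" for n x
  have k_meas[measurable]: "k \<in> borel_measurable \<mu>"
    using k by (simp add: square_integrable_def)
  have T_meas[measurable]: "T n \<in> borel_measurable \<mu>" for n
    unfolding T_def by measurable
  have T_le: "\<bar>k x - T n x\<bar> \<le> \<bar>k x\<bar>" for n x
    unfolding T_def by (auto simp: max_def min_def)
  have T_bounded: "\<bar>T n x\<bar> \<le> real n" for n x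
    unfolding T_def by (auto simp: max_def min_def)
  have T_ev: "\<forall>\<^sub>F n in sequentially. T n x = k x" for x
    using eventually_ge_at_top[of "nat \<lceil>\<bar>k x\<bar>\<rceil>"]
  proof eventually_elim
    case (elim n)
    then have "\<bar>k x\<bar> \<le> real n" by linarith
    then show ?case unfolding T_def by (auto simp: max_def min_def)
  qed
  have "(\<lambda>n. \<mu>.expectation (\<lambda>x. (k x - T n x)\<^sup>2)) \<longlonglongrightarrow> \<mu>.expectation (\<lambda>x. 0)"
  proof (rule integral_dominated_convergence[where w = "\<lambda>x. (k x)\<^sup>2"])
    show "integrable \<mu> (\<lambda>x. (k x)\<^sup>2)" using k by (simp add: square_integrable_def)
    show "AE x in \<mu>. (\<lambda>n. (k x - T n x)\<^sup>2) \<longlonglongrightarrow> 0"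
    proof (rule AE_I2)
      fix x
      show "(\<lambda>n. (k x - T n x)\<^sup>2) \<longlonglongrightarrow> 0"
        using T_ev[of x] by (intro tendsto_eventually) (auto elim: eventually_mono)
    qed
    show "AE x in \<mu>. norm ((k x - T n x)\<^sup>2) \<le> (k x)\<^sup>2" for n
      using T_le[of _ n] by (auto simp: abs_le_square_iff)
  qed auto
  then have "\<forall>\<^sub>F n in sequentially. \<mu>.expectation (\<lambda>x. (k x - T n x)\<^sup>2) < e\<^sup>2"
    using e by (intro order_tendstoD) auto
  then obtain n where n: "\<mu>.expectation (\<lambda>x. (k x - T n x)\<^sup>2) < e\<^sup>2"
    using eventually_happens by fastforce
  define m where "m = \<mu>.expectation (T n)"
  have T_sq: "square_integrable \<mu> (T n)"
    by (rule \<mu>.square_integrable_bounded[OF T_meas T_bounded])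
  define h where "h = (\<lambda>x. T n x - m)"
  have "h \<in> bounded_scores \<mu>"
  proof -
    have "\<bar>h x\<bar> \<le> real n + \<bar>m\<bar>" for x
      using T_bounded[of n x] unfolding h_def by linarith
    then have "bounded (range h)" by (auto simp: bounded_iff)
    moreover have "\<mu>.expectation h = 0"
      using \<mu>.square_integrable_integrable[OF T_sq] by (simp add: h_def m_def \<mu>.prob_space)
    ultimately show ?thesis
      by (simp add: bounded_scores_def measurable_\<mu> h_def)
  qed
  moreover have "sd \<mu> (\<lambda>x. k x - h x) \<le> e"
  proof -
    have d: "square_integrable \<mu> (\<lambda>x. k x - T n x)" by (rule square_integrable_diff[OF k T_sq])
    have c: "square_integrable \<mu> (\<lambda>x. m)"
      by (rule \<mu>.square_integrable_bounded[where B = "\<bar>m\<bar>"]) auto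
    have "sd \<mu> (\<lambda>x. (k x - T n x) - (- m)) \<le> sd \<mu> (\<lambda>x. ((k x - T n x) - (- m)) - (k x - T n x)) + sd \<mu> (\<lambda>x. k x - T n x)"
      by (rule \<mu>.sd_triangle[OF square_integrable_diff[OF d] d])
        (rule \<mu>.square_integrable_bounded[where B = "\<bar>m\<bar>"]; simp)
    also have "sd \<mu> (\<lambda>x. ((k x - T n x) - (- m)) - (k x - T n x)) = 0"
      by (simp add: sd_def covar_def \<mu>.prob_space)
    also have "sd \<mu> (\<lambda>x. k x - T n x) \<le> e"
      using n e by (intro \<mu>.sd_le_second_moment) auto
    finally show ?thesis by (simp add: h_def algebra_simps)
  qed
  ultimately show ?thesis by blast
qed

lemma lin_bounded_scores: "lin (bounded_scores \<mu>) = bounded_scores \<mu>"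
proof
  show "bounded_scores \<mu> \<subseteq> lin (bounded_scores \<mu>)"
  proof
    fix h assume h: "h \<in> bounded_scores \<mu>"
    show "h \<in> lin (bounded_scores \<mu>)"
      unfolding lin_def mem_Collect_eq
      by (rule exI[of _ "{h}"], rule exI[of _ "\<lambda>_. 1"]) (use h in simp)
  qed
  show "lin (bounded_scores \<mu>) \<subseteq> bounded_scores \<mu>"
  proof
    fix h assume "h \<in> lin (bounded_scores \<mu>)"
    then obtain A c where h: "h = (\<lambda>x. \<Sum>g\<in>A. c g * g x)" and A: "finite A" "A \<subseteq> bounded_scores \<mu>"
      unfolding lin_def by blast
    have "\<exists>B. \<forall>x. \<bar>g x\<bar> \<le> B" if "g \<in> A" for g
      using that A by (auto simp: bounded_scores_def bounded_iff)
    then obtain B where B: "\<And>g x. g \<in> A \<Longrightarrow> \<bar>g x\<bar> \<le> B g" by metis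
    have "\<bar>h x\<bar> \<le> (\<Sum>g\<in>A. \<bar>c g\<bar> * B g)" for x
      unfolding h
      by (rule order_trans[OF sum_abs]) (auto simp: abs_mult intro!: sum_mono mult_left_mono B)
    then have "bounded (range h)" by (auto simp: bounded_iff)
    moreover have "\<mu>.expectation h = 0"
    proof -
      have "integrable \<mu> g" "\<mu>.expectation g = 0" if "g \<in> A" for g
        using that A bounded_scores_square_integrable
        by (auto intro!: \<mu>.square_integrable_integrable simp: bounded_scores_def)
      then show ?thesis
        unfolding h by (subst Bochner_Integration.integral_sum) auto
    qed
    moreover have "h \<in> borel_measurable borel"
      unfolding h using A by (intro borel_measurable_sum borel_measurable_times) (auto simp: bounded_scores_def)
    ultimately show "h \<in> bounded_scores \<mu>" by (simp add: bounded_scores_def)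
  qed
qed

end

section \<open>Scores of linear submodels\<close>

text \<open>With \<open>s = sqrt (1 + u)\<close> the error is \<open>- (s - 1)\<^sup>2 / 2\<close>, while \<open>u = (s - 1) (s + 1)\<close> with \<open>s + 1 \<ge> 1\<close>.\<close>

lemma sqrt_first_order:
  fixes u :: real
  assumes "-1 \<le> u"
  shows "\<bar>sqrt (1 + u) - 1 - u / 2\<bar> \<le> u\<^sup>2 / 2"
proof -
  define s where "s = sqrt (1 + u)"
  have "s\<^sup>2 = 1 + u" unfolding s_def using assms by (intro real_sqrt_pow2) simp
  moreover have "0 \<le> s" unfolding s_def using assms by (intro real_sqrt_ge_zero) simp
  ultimately have s: "0 \<le> s" "u = s\<^sup>2 - 1" by linarith+
  have "sqrt (1 + u) - 1 - u / 2 = - (s - 1)\<^sup>2 / 2"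
    unfolding s_def[symmetric] s(2) using s(1) by (simp add: power2_eq_square field_simps)
  moreover have "(s - 1)\<^sup>2 * 1 \<le> (s - 1)\<^sup>2 * (s + 1)\<^sup>2"
    using s(1) by (intro mult_left_mono) (auto simp: one_le_power)
  then have "(s - 1)\<^sup>2 \<le> u\<^sup>2"
    unfolding s(2) by (simp add: power2_eq_square algebra_simps)
  ultimately show ?thesis by simp
qed

lemma eventually_small:
  assumes "0 \<le> (B::real)" "0 < c"
  shows "\<forall>\<^sub>F t in at_right (0::real). 0 < t \<and> t * B \<le> c"
proof -
  have "((\<lambda>t::real. t * B) \<longlongrightarrow> 0 * B) (at_right 0)" by (intro tendsto_intros)
  then have "\<forall>\<^sub>F t in at_right (0::real). t * B < c"
    using assms by (intro order_tendstoD) auto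
  with eventually_at_right_less[of 0] show ?thesis
    by eventually_elim auto
qed

context borel_prob_space
begin

text \<open>The integral that defines a score does not depend on the dominating measure: the density of \<open>\<mu>\<close> factors out of the
square.\<close>

lemma hellinger_integral_tilt:
  assumes N: "sigma_finite_measure N" "sets N = sets borel" "absolutely_continuous N \<mu>"
    and g: "g \<in> borel_measurable borel" and h: "h \<in> borel_measurable borel"
    and pos: "\<And>x. 0 \<le> 1 + t * g x"
  shows "(\<integral>\<^sup>+x. ennreal (((sqrt (enn2real (RN_deriv N (tilt \<mu> (\<lambda>x. t * g x)) x))
        - sqrt (enn2real (RN_deriv N \<mu> x))) / t
        - (1/2) * h x * sqrt (enn2real (RN_deriv N \<mu> x)))\<^sup>2) \<partial>N) =
    (\<integral>\<^sup>+x. ennreal (((sqrt (1 + t * g x) - 1) / t - (1/2) * h x)\<^sup>2) \<partial>\<mu>)"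
proof -
  interpret N: sigma_finite_measure N by fact
  have [measurable_cong]: "sets N = sets borel" "sets \<mu> = sets borel" by (fact N(2) sets_\<mu>)+
  note [measurable] = g h
  let ?p = "RN_deriv N \<mu>"
  let ?q = "\<lambda>x. (sqrt (1 + t * g x) - 1) / t - (1/2) * h x"
  have dens: "density N ?p = \<mu>"
    using N.density_RN_deriv[OF N(3)] N(2) sets_\<mu> by simp
  have fin: "AE x in N. ?p x \<noteq> \<infinity>"
    by (rule N.RN_deriv_finite) (use N(2,3) sets_\<mu> in \<open>auto intro: \<mu>.sigma_finite_measure_axioms\<close>)
  have "density N (\<lambda>x. ?p x * ennreal (1 + t * g x)) = density (density N ?p) (\<lambda>x. ennreal (1 + t * g x))"
    by (subst density_density_eq) auto
  then have "density N (\<lambda>x. ?p x * ennreal (1 + t * g x)) = tilt \<mu> (\<lambda>x. t * g x)"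
    by (simp add: dens tilt_def)
  then have RN: "AE x in N. ?p x * ennreal (1 + t * g x) = RN_deriv N (tilt \<mu> (\<lambda>x. t * g x)) x"
    by (intro N.RN_deriv_unique) auto
  have "(\<integral>\<^sup>+x. ennreal (((sqrt (enn2real (RN_deriv N (tilt \<mu> (\<lambda>x. t * g x)) x))
        - sqrt (enn2real (?p x))) / t - (1/2) * h x * sqrt (enn2real (?p x)))\<^sup>2) \<partial>N) =
      (\<integral>\<^sup>+x. ?p x * ennreal ((?q x)\<^sup>2) \<partial>N)"
  proof (rule nn_integral_cong_AE, use fin RN in eventually_elim)
    case (elim x)
    define p where "p = enn2real (?p x)"
    have p: "0 \<le> p" "?p x = ennreal p"
      using elim(1) by (auto simp: p_def less_top)
    have RNx: "enn2real (RN_deriv N (tilt \<mu> (\<lambda>x. t * g x)) x) = p * (1 + t * g x)"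
      unfolding elim(2)[symmetric] by (simp add: enn2real_mult p_def pos)
    have factor: "(a * r - a) / t - (1/2) * k * a = a * ((r - 1) / t - (1/2) * k)" for a r k :: real
      by (simp add: diff_divide_distrib algebra_simps)
    have "(sqrt (p * (1 + t * g x)) - sqrt p) / t - (1/2) * h x * sqrt p = sqrt p * ?q x"
      unfolding real_sqrt_mult by (rule factor)
    then have eq: "((sqrt (p * (1 + t * g x)) - sqrt p) / t - (1/2) * h x * sqrt p)\<^sup>2 = p * (?q x)\<^sup>2"
      using p(1) by (simp only: power_mult_distrib real_sqrt_pow2)
    have "?p x * ennreal ((?q x)\<^sup>2) = ennreal (p * (?q x)\<^sup>2)"
      using p by (simp only: ennreal_mult zero_le_power2)
    then show ?case
      unfolding RNx p_def[symmetric] eq by (rule sym)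
  qed
  also have "\<dots> = (\<integral>\<^sup>+x. ennreal ((?q x)\<^sup>2) \<partial>density N ?p)"
    by (subst nn_integral_density) auto
  finally show ?thesis unfolding dens .
qed

text \<open>By \<open>sqrt_first_order\<close> the integrand is at most \<open>(t B\<^sup>2)\<^sup>2\<close> for a bound \<open>B\<close> of \<open>g\<close>.\<close>

lemma hellinger_integral_linear_tendsto:
  assumes g: "g \<in> bounded_scores \<mu>"
  shows "((\<lambda>t. \<integral>\<^sup>+x. ennreal (((sqrt (1 + t * g x) - 1) / t - (1/2) * g x)\<^sup>2) \<partial>\<mu>) \<longlongrightarrow> 0) (at_right 0)"
proof -
  obtain B where B: "0 < B" "\<And>x. \<bar>g x\<bar> \<le> B"
    "\<And>t x. 0 \<le> t \<Longrightarrow> t * B \<le> 1 / 2 \<Longrightarrow> 1 / 2 \<le> 1 + t * g x"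
    using bounded_score_bound[OF g] by blast
  have le: "\<forall>\<^sub>F t in at_right 0. (\<integral>\<^sup>+x. ennreal (((sqrt (1 + t * g x) - 1) / t - (1/2) * g x)\<^sup>2) \<partial>\<mu>)
      \<le> ennreal ((t * B\<^sup>2)\<^sup>2)"
    using eventually_small[of B "1 / 2"] B(1)
  proof (rule_tac eventually_mono)
    fix t :: real assume t: "0 < t \<and> t * B \<le> 1 / 2"
    have "((sqrt (1 + t * g x) - 1) / t - (1/2) * g x)\<^sup>2 \<le> (t * B\<^sup>2)\<^sup>2" for x
    proof -
      have "\<bar>sqrt (1 + t * g x) - 1 - t * g x / 2\<bar> \<le> (t * g x)\<^sup>2 / 2"
        using B(3)[of t x] t by (intro sqrt_first_order) auto
      also have "\<dots> \<le> (t * B)\<^sup>2"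
      proof -
        have "\<bar>t * g x\<bar> \<le> \<bar>t * B\<bar>" using B(1) B(2)[of x] t by (simp add: abs_mult mult_left_mono)
        then have "(t * g x)\<^sup>2 \<le> (t * B)\<^sup>2" by (simp add: abs_le_square_iff)
        then show ?thesis using zero_le_power2[of "t * g x"] by linarith
      qed
      finally have "\<bar>sqrt (1 + t * g x) - 1 - t * g x / 2\<bar> / t \<le> (t * B)\<^sup>2 / t"
        using t by (intro divide_right_mono) auto
      moreover have "\<bar>sqrt (1 + t * g x) - 1 - t * g x / 2\<bar> / t = \<bar>(sqrt (1 + t * g x) - 1) / t - (1/2) * g x\<bar>"
      proof -
        have "(sqrt (1 + t * g x) - 1 - t * g x / 2) / t = (sqrt (1 + t * g x) - 1) / t - (1/2) * g x"
          using t by (simp add: diff_divide_distrib)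
        then show ?thesis using t by (metis abs_divide abs_of_pos)
      qed
      moreover have "(t * B)\<^sup>2 / t = t * B\<^sup>2" using t by (simp add: power2_eq_square)
      ultimately have "\<bar>(sqrt (1 + t * g x) - 1) / t - (1/2) * g x\<bar> \<le> \<bar>t * B\<^sup>2\<bar>"
        using t by simp
      then show ?thesis by (simp only: abs_le_square_iff)
    qed
    then have "(\<integral>\<^sup>+x. ennreal (((sqrt (1 + t * g x) - 1) / t - (1/2) * g x)\<^sup>2) \<partial>\<mu>)
        \<le> (\<integral>\<^sup>+x. ennreal ((t * B\<^sup>2)\<^sup>2) \<partial>\<mu>)"
      by (intro nn_integral_mono ennreal_leI)
    then show "(\<integral>\<^sup>+x. ennreal (((sqrt (1 + t * g x) - 1) / t - (1/2) * g x)\<^sup>2) \<partial>\<mu>)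
        \<le> ennreal ((t * B\<^sup>2)\<^sup>2)"
      by (simp add: \<mu>.emeasure_space_1)
  qed auto
  have "((\<lambda>t. ennreal ((t * B\<^sup>2)\<^sup>2)) \<longlongrightarrow> ennreal ((0 * B\<^sup>2)\<^sup>2)) (at_right 0)"
    by (intro tendsto_intros)
  then have lim: "((\<lambda>t. ennreal ((t * B\<^sup>2)\<^sup>2)) \<longlongrightarrow> 0) (at_right 0)" by simp
  show ?thesis
    by (rule tendsto_sandwich[OF _ le tendsto_const lim]) simp
qed

lemma has_score_linear:
  assumes g: "g \<in> bounded_scores \<mu>"
  shows "has_score \<mu> (\<lambda>t. tilt \<mu> (\<lambda>x. t * g x)) g"
proof -
  obtain B where B: "0 < B" "\<And>x. \<bar>g x\<bar> \<le> B"
    "\<And>t x. 0 \<le> t \<Longrightarrow> t * B \<le> 1 / 2 \<Longrightarrow> 1 / 2 \<le> 1 + t * g x"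
    using bounded_score_bound[OF g] by blast
  have gm: "g \<in> borel_measurable borel" using g by (simp add: bounded_scores_def)
  have g\<mu>[measurable]: "g \<in> borel_measurable \<mu>" using gm by (simp add: measurable_\<mu>)
  have ac: "absolutely_continuous \<mu> \<mu>" by (simp add: absolutely_continuous_def)
  have "\<forall>\<^sub>F t in at_right 0. absolutely_continuous \<mu> (tilt \<mu> (\<lambda>x. t * g x))"
    unfolding tilt_def by (intro always_eventually allI absolutely_continuousI_density) simp
  moreover have "\<forall>\<^sub>F t in at_right 0.
      (\<integral>\<^sup>+x. ennreal (((sqrt (1 + t * g x) - 1) / t - (1/2) * g x)\<^sup>2) \<partial>\<mu>) =
      (\<integral>\<^sup>+x. ennreal (((sqrt (enn2real (RN_deriv \<mu> (tilt \<mu> (\<lambda>x. t * g x)) x))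
        - sqrt (enn2real (RN_deriv \<mu> \<mu> x))) / t
        - (1/2) * g x * sqrt (enn2real (RN_deriv \<mu> \<mu> x)))\<^sup>2) \<partial>\<mu>)"
    using eventually_small[of B "1 / 2"] B(1)
  proof (rule_tac eventually_mono)
    fix t :: real assume "0 < t \<and> t * B \<le> 1 / 2"
    then have "0 \<le> 1 + t * g x" for x using B(3)[of t x] by linarith
    then show "(\<integral>\<^sup>+x. ennreal (((sqrt (1 + t * g x) - 1) / t - (1/2) * g x)\<^sup>2) \<partial>\<mu>) =
      (\<integral>\<^sup>+x. ennreal (((sqrt (enn2real (RN_deriv \<mu> (tilt \<mu> (\<lambda>x. t * g x)) x))
        - sqrt (enn2real (RN_deriv \<mu> \<mu> x))) / t
        - (1/2) * g x * sqrt (enn2real (RN_deriv \<mu> \<mu> x)))\<^sup>2) \<partial>\<mu>)"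
      by (rule hellinger_integral_tilt[OF \<mu>.sigma_finite_measure_axioms sets_\<mu> ac gm gm, symmetric])
  qed auto
  from tendsto_cong[OF this, THEN iffD1, OF hellinger_integral_linear_tendsto[OF g]]
  have "((\<lambda>t. \<integral>\<^sup>+x. ennreal (((sqrt (enn2real (RN_deriv \<mu> (tilt \<mu> (\<lambda>x. t * g x)) x))
        - sqrt (enn2real (RN_deriv \<mu> \<mu> x))) / t
        - (1/2) * g x * sqrt (enn2real (RN_deriv \<mu> \<mu> x)))\<^sup>2) \<partial>\<mu>) \<longlongrightarrow> 0) (at_right 0)" .
  ultimately show ?thesis
    unfolding has_score_def using gm ac sets_\<mu> \<mu>.sigma_finite_measure_axioms by blast
qed

text \<open>The integrals for the two candidates \<open>h\<close> and \<open>g\<close> are squared distances from the same difference quotient to \<open>h / 2\<close>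
and \<open>g / 2\<close> in \<open>L\<^sup>2(\<mu>)\<close>. Both tend to \<open>0\<close>, and the parallelogram inequality bounds the fixed distance between \<open>h\<close>
and \<open>g\<close> by them.\<close>

lemma has_score_unique:
  assumes g: "g \<in> bounded_scores \<mu>"
    and h: "has_score \<mu> (\<lambda>t. tilt \<mu> (\<lambda>x. t * g x)) h"
  shows "AE x in \<mu>. h x = g x"
proof -
  obtain B where B: "0 < B" "\<And>x. \<bar>g x\<bar> \<le> B"
    "\<And>t x. 0 \<le> t \<Longrightarrow> t * B \<le> 1 / 2 \<Longrightarrow> 1 / 2 \<le> 1 + t * g x"
    using bounded_score_bound[OF g] by blast
  have gm: "g \<in> borel_measurable borel" using g by (simp add: bounded_scores_def)
  have hm: "h \<in> borel_measurable borel" using h by (simp add: has_score_def)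
  have [measurable]: "g \<in> borel_measurable \<mu>" "h \<in> borel_measurable \<mu>"
    using gm hm by (simp_all add: measurable_\<mu>)
  let ?I = "\<lambda>h t. \<integral>\<^sup>+x. ennreal (((sqrt (1 + t * g x) - 1) / t - (1/2) * h x)\<^sup>2) \<partial>\<mu>"
  obtain N where N: "sigma_finite_measure N" "sets N = sets borel" "absolutely_continuous N \<mu>"
    and lim: "((\<lambda>t. \<integral>\<^sup>+x. ennreal (((sqrt (enn2real (RN_deriv N (tilt \<mu> (\<lambda>x. t * g x)) x))
        - sqrt (enn2real (RN_deriv N \<mu> x))) / t
        - (1/2) * h x * sqrt (enn2real (RN_deriv N \<mu> x)))\<^sup>2) \<partial>N) \<longlongrightarrow> 0) (at_right 0)"
    using h unfolding has_score_def by blast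
  have "\<forall>\<^sub>F t in at_right 0.
      (\<integral>\<^sup>+x. ennreal (((sqrt (enn2real (RN_deriv N (tilt \<mu> (\<lambda>x. t * g x)) x))
        - sqrt (enn2real (RN_deriv N \<mu> x))) / t
        - (1/2) * h x * sqrt (enn2real (RN_deriv N \<mu> x)))\<^sup>2) \<partial>N) = ?I h t"
    using eventually_small[of B "1 / 2"] B(1)
  proof (rule_tac eventually_mono)
    fix t :: real assume "0 < t \<and> t * B \<le> 1 / 2"
    then have "0 \<le> 1 + t * g x" for x using B(3)[of t x] by linarith
    then show "(\<integral>\<^sup>+x. ennreal (((sqrt (enn2real (RN_deriv N (tilt \<mu> (\<lambda>x. t * g x)) x))
        - sqrt (enn2real (RN_deriv N \<mu> x))) / t
        - (1/2) * h x * sqrt (enn2real (RN_deriv N \<mu> x)))\<^sup>2) \<partial>N) = ?I h t"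
      by (rule hellinger_integral_tilt[OF N gm hm])
  qed auto
  from tendsto_cong[OF this, THEN iffD1, OF lim] have "(?I h \<longlongrightarrow> 0) (at_right 0)" .
  then have "((\<lambda>t. ennreal 8 * ?I h t + ennreal 8 * ?I g t) \<longlongrightarrow> ennreal 8 * 0 + ennreal 8 * 0) (at_right 0)"
    by (intro tendsto_add ennreal_tendsto_cmult hellinger_integral_linear_tendsto g) auto
  moreover have "(\<integral>\<^sup>+x. ennreal ((h x - g x)\<^sup>2) \<partial>\<mu>) \<le> ennreal 8 * ?I h t + ennreal 8 * ?I g t" for t
  proof -
    have le: "(a - b)\<^sup>2 \<le> 8 * (c - (1/2) * a)\<^sup>2 + 8 * (c - (1/2) * b)\<^sup>2" for a b c :: real
    proof -
      have "8 * (c - (1/2) * a)\<^sup>2 + 8 * (c - (1/2) * b)\<^sup>2 - (a - b)\<^sup>2 = (4 * c - a - b)\<^sup>2"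
        by (simp add: power2_eq_square algebra_simps)
      then show ?thesis by (smt (verit) zero_le_power2)
    qed
    have e8: "ennreal 8 * ennreal (c\<^sup>2) + ennreal 8 * ennreal (d\<^sup>2) = ennreal (8 * c\<^sup>2 + 8 * d\<^sup>2)" for c d :: real
      by (simp only: ennreal_plus ennreal_mult zero_le_power2 mult_nonneg_nonneg zero_le_numeral)
    have "(\<integral>\<^sup>+x. ennreal ((h x - g x)\<^sup>2) \<partial>\<mu>) \<le>
        (\<integral>\<^sup>+x. ennreal 8 * ennreal (((sqrt (1 + t * g x) - 1) / t - (1/2) * h x)\<^sup>2)
          + ennreal 8 * ennreal (((sqrt (1 + t * g x) - 1) / t - (1/2) * g x)\<^sup>2) \<partial>\<mu>)"
      by (intro nn_integral_mono) (unfold e8, rule ennreal_leI, rule le)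
    also have "\<dots> = ennreal 8 * ?I h t + ennreal 8 * ?I g t"
      by (subst nn_integral_add) (simp_all add: nn_integral_cmult)
    finally show ?thesis .
  qed
  ultimately have "(\<integral>\<^sup>+x. ennreal ((h x - g x)\<^sup>2) \<partial>\<mu>) \<le> ennreal 8 * 0 + ennreal 8 * 0"
    by (intro tendsto_lowerbound[OF _ always_eventually]) auto
  then have "(\<integral>\<^sup>+x. ennreal ((h x - g x)\<^sup>2) \<partial>\<mu>) = 0" by simp
  then show ?thesis
    by (subst (asm) nn_integral_0_iff_AE) auto
qed

lemma mixture_tilt:
  assumes g: "g \<in> borel_measurable borel" and pos: "\<And>x. 0 \<le> 1 + g x" and t: "0 \<le> t" "t \<le> 1"
  shows "mixture t \<mu> (tilt \<mu> g) = tilt \<mu> (\<lambda>x. t * g x)"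
proof -
  have [measurable]: "g \<in> borel_measurable \<mu>" using g by (simp add: measurable_\<mu>)
  let ?m = "tilt \<mu> (\<lambda>x. t * g x)"
  have sp: "space ?m = UNIV" "sets ?m = sets borel"
    using sets_\<mu> sets_eq_imp_space_eq[OF sets_\<mu>] by (simp_all add: tilt_def)
  have "emeasure ?m A = ennreal (1 - t) * emeasure \<mu> A + ennreal t * emeasure (tilt \<mu> g) A"
    if A: "A \<in> sets borel" for A
  proof -
    have [measurable]: "A \<in> sets \<mu>" using A sets_\<mu> by simp
    have "emeasure ?m A = (\<integral>\<^sup>+x. ennreal (1 + t * g x) * indicator A x \<partial>\<mu>)"
      by (simp add: tilt_def emeasure_density)
    also have "\<dots> = (\<integral>\<^sup>+x. ennreal (1 - t) * indicator A x + ennreal t * (ennreal (1 + g x) * indicator A x) \<partial>\<mu>)"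
    proof (intro nn_integral_cong)
      fix x
      have "ennreal (1 - t) + ennreal t * ennreal (1 + g x) = ennreal ((1 - t) + t * (1 + g x))"
        using t pos[of x] by (simp only: ennreal_plus ennreal_mult diff_ge_0_iff_ge mult_nonneg_nonneg)
      also have "(1 - t) + t * (1 + g x) = 1 + t * g x" by (simp add: algebra_simps)
      finally show "ennreal (1 + t * g x) * indicator A x =
          ennreal (1 - t) * indicator A x + ennreal t * (ennreal (1 + g x) * indicator A x)"
        by (simp only: distrib_right[symmetric] mult.assoc[symmetric])
    qed
    also have "\<dots> = ennreal (1 - t) * emeasure \<mu> A + ennreal t * emeasure (tilt \<mu> g) A"
      by (subst nn_integral_add) (simp_all add: nn_integral_cmult tilt_def emeasure_density)
    finally show ?thesis .
  qed
  then have "mixture t \<mu> (tilt \<mu> g) = measure_of UNIV (sets borel) (emeasure ?m)"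
    unfolding mixture_def
    by (intro measure_of_eq) (auto simp: sets.sigma_sets_eq[of borel, simplified])
  also have "\<dots> = ?m"
    using measure_of_of_measure[of ?m] by (simp add: sp)
  finally show ?thesis .
qed

end

section \<open>Finite approximation of the Gaussian process\<close>

locale pre_gaussian_functional = borel_prob_space \<mu>
  for \<mu> :: "'a::topological_space measure" +
  fixes \<F> :: "('a \<Rightarrow> real) set"
    and M :: "'b measure" and G :: "'b \<Rightarrow> ('a \<Rightarrow> real) \<Rightarrow> real"
    and L :: "(('a \<Rightarrow> real) \<Rightarrow> real) \<Rightarrow> real"
  assumes class_measurable: "\<F> \<subseteq> borel_measurable borel"
    and pre_gaussian: "pre_gaussian_process \<mu> \<F> M G"
    and L: "continuous_linear_linf \<F> L"
begin

sublocale M: prob_space M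
  using pre_gaussian by (simp add: pre_gaussian_process_def)

lemma class_square_integrable: "f \<in> \<F> \<Longrightarrow> square_integrable \<mu> f"
  using pre_gaussian class_measurable measurable_\<mu>
  by (auto simp: pre_gaussian_process_def square_integrable_def)

lemma G_measurable:
  "G \<in> measurable M (sigma (mspace (linf \<F>)) {U. openin (mtopology_of (linf \<F>)) U})"
  using pre_gaussian by (simp add: pre_gaussian_process_def tight_random_element_def)

lemma G_in_linf: "\<omega> \<in> space M \<Longrightarrow> G \<omega> \<in> mspace (linf \<F>)"
  using measurable_space[OF G_measurable] openin_subset[of "mtopology_of (linf \<F>)"]
  by (simp add: space_measure_of_conv)

lemma G_covar: "f \<in> \<F> \<Longrightarrow> g \<in> \<F> \<Longrightarrow> covar M (\<lambda>\<omega>. G \<omega> f) (\<lambda>\<omega>. G \<omega> g) = covar \<mu> f g"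
  using pre_gaussian by (simp add: pre_gaussian_process_def)

lemma G_gaussian: "finite J \<Longrightarrow> J \<subseteq> \<F> \<Longrightarrow> gaussian_rv M (\<lambda>\<omega>. \<Sum>f\<in>J. c f * G \<omega> f)"
  using pre_gaussian by (simp add: pre_gaussian_process_def gaussian_process_def)

lemma G_square_integrable: "f \<in> \<F> \<Longrightarrow> square_integrable M (\<lambda>\<omega>. G \<omega> f)"
  using M.gaussian_rv_square_integrable[OF G_gaussian[of "{f}" "\<lambda>_. 1"]] by simp

definition G_combinations :: "('b \<Rightarrow> real) set" where
  "G_combinations = {(\<lambda>\<omega>. \<Sum>f\<in>J. c f * G \<omega> f) | J c. finite J \<and> J \<subseteq> \<F>}"

lemma G_combinationsD:
  assumes "Y \<in> G_combinations"
  shows "gaussian_rv M Y" "M.expectation Y = 0" "square_integrable M Y"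
proof -
  obtain J c where J: "finite J" "J \<subseteq> \<F>" and Y: "Y = (\<lambda>\<omega>. \<Sum>f\<in>J. c f * G \<omega> f)"
    using assms by (auto simp: G_combinations_def)
  show *: "gaussian_rv M Y" unfolding Y by (rule G_gaussian) fact+
  show "square_integrable M Y" by (rule M.gaussian_rv_square_integrable) fact
  have "integrable M (\<lambda>\<omega>. G \<omega> f)" if "f \<in> J" for f
    using that J by (intro M.square_integrable_integrable G_square_integrable) auto
  moreover have "M.expectation (\<lambda>\<omega>. G \<omega> f) = 0" if "f \<in> J" for f
    using that J pre_gaussian by (auto simp: pre_gaussian_process_def)
  ultimately show "M.expectation Y = 0"
    unfolding Y by (subst Bochner_Integration.integral_sum) auto
qed

lemma G_combinations_diff:
  assumes "Y \<in> G_combinations" "Y' \<in> G_combinations"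
  shows "(\<lambda>\<omega>. Y \<omega> - Y' \<omega>) \<in> G_combinations"
proof -
  obtain J c where J: "finite J" "J \<subseteq> \<F>" and Y: "Y = (\<lambda>\<omega>. \<Sum>f\<in>J. c f * G \<omega> f)"
    using assms by (auto simp: G_combinations_def)
  obtain J' c' where J': "finite J'" "J' \<subseteq> \<F>" and Y': "Y' = (\<lambda>\<omega>. \<Sum>f\<in>J'. c' f * G \<omega> f)"
    using assms by (auto simp: G_combinations_def)
  have ext: "(\<Sum>f\<in>I. d f * G \<omega> f) = (\<Sum>f\<in>J \<union> J'. (if f \<in> I then d f else 0) * G \<omega> f)"
    if "I \<subseteq> J \<union> J'" for I d \<omega>
    using that J J' by (intro sum.mono_neutral_cong_left) auto
  have "(\<lambda>\<omega>. Y \<omega> - Y' \<omega>) = (\<lambda>\<omega>. \<Sum>f\<in>J \<union> J'.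
      ((if f \<in> J then c f else 0) - (if f \<in> J' then c' f else 0)) * G \<omega> f)"
    unfolding Y Y' by (subst ext[of J], simp, subst ext[of J'], simp)
      (simp only: left_diff_distrib sum_subtractf)
  moreover have "finite (J \<union> J')" "J \<union> J' \<subseteq> \<F>" using J J' by auto
  ultimately show ?thesis
    unfolding G_combinations_def mem_Collect_eq
    by (intro exI[of _ "J \<union> J'"] exI[of _ "\<lambda>f. (if f \<in> J then c f else 0) - (if f \<in> J' then c' f else 0)"] conjI)
qed

lemma G_in_combinations: "f \<in> \<F> \<Longrightarrow> (\<lambda>\<omega>. G \<omega> f) \<in> G_combinations"
  unfolding G_combinations_def mem_Collect_eq
  by (rule exI[of _ "{f}"], rule exI[of _ "\<lambda>_. 1"]) simp

text \<open>The linear map with \<open>G(f) \<mapsto> f\<close> preserves covariances, hence standard deviations.\<close>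

lemma sd_G_combination:
  assumes J: "finite J" "J \<subseteq> \<F>"
  shows "sd M (\<lambda>\<omega>. \<Sum>f\<in>J. c f * G \<omega> f) = sd \<mu> (\<lambda>x. \<Sum>f\<in>J. c f * f x)"
proof -
  have sqM: "square_integrable M (\<lambda>\<omega>. G \<omega> f)" and sq\<mu>: "square_integrable \<mu> f" if "f \<in> J" for f
    using that J G_square_integrable class_square_integrable by auto
  let ?Y = "\<lambda>\<omega>. \<Sum>f\<in>J. c f * G \<omega> f" and ?k = "\<lambda>x. \<Sum>f\<in>J. c f * f x"
  have Y: "square_integrable M ?Y" and k: "square_integrable \<mu> ?k"
    using J(1) sqM sq\<mu> by (auto intro!: square_integrable_sum)
  have "covar M ?Y ?Y = (\<Sum>f\<in>J. c f * covar M (\<lambda>\<omega>. G \<omega> f) ?Y)"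
    by (intro M.covar_sum_left J sqM Y)
  also have "\<dots> = (\<Sum>f\<in>J. c f * covar \<mu> f ?k)"
  proof (rule sum.cong[OF refl])
    fix f assume f: "f \<in> J"
    have "covar M (\<lambda>\<omega>. G \<omega> f) ?Y = (\<Sum>g\<in>J. c g * covar M (\<lambda>\<omega>. G \<omega> g) (\<lambda>\<omega>. G \<omega> f))"
      by (subst covar_commute) (intro M.covar_sum_left J sqM f)
    also have "\<dots> = (\<Sum>g\<in>J. c g * covar \<mu> g f)"
      using f J by (intro sum.cong refl) (subst G_covar, auto)
    also have "\<dots> = covar \<mu> f ?k"
      by (subst (2) covar_commute) (intro \<mu>.covar_sum_left[symmetric] J sq\<mu> f)
    finally show "c f * covar M (\<lambda>\<omega>. G \<omega> f) ?Y = c f * covar \<mu> f ?k" by simp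
  qed
  also have "\<dots> = covar \<mu> ?k ?k"
    by (intro \<mu>.covar_sum_left[symmetric] J sq\<mu> k)
  finally show ?thesis by (simp add: sd_def)
qed

lemma sd_G_diff:
  assumes "f \<in> \<F>" "g \<in> \<F>"
  shows "sd M (\<lambda>\<omega>. G \<omega> f - G \<omega> g) = sd \<mu> (\<lambda>x. f x - g x)"
  using M.covar_diff_self[OF G_square_integrable G_square_integrable, of f g 1]
    \<mu>.covar_diff_self[OF class_square_integrable class_square_integrable, of f g 1] assms
  by (simp add: sd_def G_covar)

text \<open>The law of \<open>G\<close> lives on the Borel sets of the sup-metric, which is what continuity of \<open>L\<close> needs.\<close>

lemma LG_measurable: "(\<lambda>\<omega>. L (G \<omega>)) \<in> borel_measurable M"
proof (rule borel_measurableI)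
  fix S :: "real set" assume S: "open S"
  let ?U = "{z \<in> mspace (linf \<F>). L z \<in> S}"
  have "openin (mtopology_of (linf \<F>)) ?U"
    using openin_continuous_map_preimage[of "mtopology_of (linf \<F>)" euclidean L S] L S
    by (simp add: continuous_linear_linf_def)
  then have "?U \<in> sets (sigma (mspace (linf \<F>)) {U. openin (mtopology_of (linf \<F>)) U})"
    using openin_subset[of "mtopology_of (linf \<F>)"]
    by (subst sets_measure_of) (auto intro!: sigma_sets.Basic)
  then have "G -` ?U \<inter> space M \<in> sets M"
    by (rule measurable_sets[OF G_measurable])
  moreover have "G -` ?U \<inter> space M = (\<lambda>\<omega>. L (G \<omega>)) -` S \<inter> space M"
    using G_in_linf by auto
  ultimately show "(\<lambda>\<omega>. L (G \<omega>)) -` S \<inter> space M \<in> sets M" by simp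
qed

text \<open>Tightness localises \<open>G\<close> to a compact set, on which one map of finite range approximates all paths uniformly.\<close>

lemma step_approximation:
  assumes e: "0 < e" and p: "0 < p"
  shows "\<exists>r A. r \<in> \<F> \<rightarrow> \<F> \<and> finite (r ` \<F>) \<and> A \<in> sets M \<and> 1 - p \<le> M.prob A \<and>
    (\<forall>\<omega>\<in>A. \<forall>f\<in>\<F>. \<bar>G \<omega> f - G \<omega> (r f)\<bar> \<le> e)"
proof -
  have "0 < min p (1 / 2)" using p by simp
  then obtain K where K: "compactin (mtopology_of (linf \<F>)) K"
    and PK: "M.prob {\<omega> \<in> space M. G \<omega> \<in> K} \<ge> 1 - min p (1 / 2)"
    using pre_gaussian unfolding pre_gaussian_process_def tight_random_element_def by blast
  obtain r where "r \<in> \<F> \<rightarrow> \<F>" "finite (r ` \<F>)" "\<forall>z\<in>K. \<forall>f\<in>\<F>. \<bar>z f - z (r f)\<bar> \<le> e"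
    using compact_linf_step_approximation[OF K e] by blast
  \<comment> \<open>A set outside the sigma-algebra would have measure \<open>0\<close>; this is why the failure probability is kept
    below \<open>1\<close>.\<close>
  moreover have "{\<omega> \<in> space M. G \<omega> \<in> K} \<in> sets M"
    using PK by (rule_tac ccontr) (simp add: measure_notin_sets)
  ultimately show ?thesis
    using PK by (intro exI[of _ r] exI[of _ "{\<omega> \<in> space M. G \<omega> \<in> K}"]) auto
qed

text \<open>Information about the paths of \<open>G\<close> yields information about \<open>\<mu>\<close>: the standard deviation of \<open>f - g\<close> is that of the
normal variable \<open>G(f) - G(g)\<close>, which an event of probability \<open>1/2\<close> controls.\<close>

lemma sd_le_of_concentration:
  assumes f: "f \<in> \<F>" and g: "g \<in> \<F>" and e: "0 \<le> e"
    and A: "A \<in> sets M" "1 / 2 \<le> M.prob A"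
    and le: "\<And>\<omega>. \<omega> \<in> A \<Longrightarrow> \<bar>G \<omega> f - G \<omega> g\<bar> \<le> e"
  shows "sd \<mu> (\<lambda>x. f x - g x) \<le> 2 * e"
proof -
  let ?Z = "\<lambda>\<omega>. G \<omega> f - G \<omega> g"
  have Z: "?Z \<in> G_combinations"
    by (intro G_combinations_diff G_in_combinations f g)
  have "M.prob {\<omega> \<in> space M. \<bar>?Z \<omega>\<bar> > e} \<le> 1 / 2"
    using A le G_combinationsD(3)[OF Z] by (intro M.prob_outside[of A]) (auto simp: square_integrable_def)
  then have "M.expectation (\<lambda>\<omega>. (?Z \<omega>)\<^sup>2) \<le> (2 * e)\<^sup>2"
    by (intro M.gaussian_small_ball G_combinationsD Z e)
  then have "sd M ?Z \<le> 2 * e"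
    using e by (intro M.sd_le_second_moment) auto
  then show ?thesis by (simp add: sd_G_diff f g)
qed

text \<open>Up to an error of \<open>2\<close>, each \<open>f\<close> has the standard deviation of one of finitely many representatives.\<close>

lemma class_sd_bounded: "\<exists>B. \<forall>f\<in>\<F>. sd \<mu> f \<le> B"
proof -
  obtain r A where r: "r \<in> \<F> \<rightarrow> \<F>" "finite (r ` \<F>)" and A: "A \<in> sets M" "1 - 1 / 2 \<le> M.prob A"
    and le: "\<And>\<omega> f. \<omega> \<in> A \<Longrightarrow> f \<in> \<F> \<Longrightarrow> \<bar>G \<omega> f - G \<omega> (r f)\<bar> \<le> 1"
    using step_approximation[of 1 "1 / 2"] by auto
  have "sd \<mu> f \<le> 2 + (\<Sum>g\<in>r ` \<F>. sd \<mu> g)" if f: "f \<in> \<F>" for f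
  proof -
    have rf: "r f \<in> \<F>" using r f by auto
    have "sd \<mu> (\<lambda>x. f x - r f x) \<le> 2 * 1"
      using A le f rf by (intro sd_le_of_concentration[where A = A]) auto
    moreover have "sd \<mu> (r f) \<le> (\<Sum>g\<in>r ` \<F>. sd \<mu> g)"
      using r f by (intro member_le_sum) (auto intro!: \<mu>.sd_nonneg class_square_integrable)
    ultimately show ?thesis
      using \<mu>.sd_triangle[OF class_square_integrable[OF f] class_square_integrable[OF rf]] by linarith
  qed
  then show ?thesis by blast
qed

section \<open>The derivative on square-integrable functions\<close>

text \<open>For mean-zero \<open>h\<close> this is the signed measure \<open>h \<mu>\<close> as a function on the class. The covariance extends it to all
square-integrable \<open>h\<close> in such a way that standard deviations alone bound it.\<close>

definition covariance_functional :: "('a \<Rightarrow> real) \<Rightarrow> ('a \<Rightarrow> real) \<Rightarrow> real" where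
  "covariance_functional h = restrict (\<lambda>f. covar \<mu> f h) \<F>"

lemma covariance_functional_bound:
  "\<exists>B\<ge>0. \<forall>h. square_integrable \<mu> h \<longrightarrow> (\<forall>f\<in>\<F>. \<bar>covar \<mu> f h\<bar> \<le> B * sd \<mu> h)"
proof -
  obtain B where B: "\<And>f. f \<in> \<F> \<Longrightarrow> sd \<mu> f \<le> B"
    using class_sd_bounded by blast
  have "\<bar>covar \<mu> f h\<bar> \<le> max B 0 * sd \<mu> h" if "square_integrable \<mu> h" "f \<in> \<F>" for f h
    using \<mu>.covar_Cauchy_Schwarz[OF class_square_integrable[OF that(2)] that(1)]
      mult_right_mono[of "sd \<mu> f" "max B 0" "sd \<mu> h"] B[OF that(2)] \<mu>.sd_nonneg[OF that(1)]
    by linarith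
  then show ?thesis by (intro exI[of _ "max B 0"]) auto
qed

lemma covariance_functional_in_linf:
  assumes "square_integrable \<mu> h"
  shows "covariance_functional h \<in> mspace (linf \<F>)"
  using covariance_functional_bound assms unfolding covariance_functional_def
  by (auto intro: restrict_in_linf)

definition derivative :: "('a \<Rightarrow> real) \<Rightarrow> real" where
  "derivative h = L (covariance_functional h)"

lemma derivative_lincomb:
  assumes g: "square_integrable \<mu> g" and h: "square_integrable \<mu> h"
  shows "derivative (\<lambda>x. a * g x + b * h x) = a * derivative g + b * derivative h"
proof -
  have "covar \<mu> f (\<lambda>x. a * g x + b * h x) = a * covar \<mu> f g + b * covar \<mu> f h" if "f \<in> \<F>" for f
    using \<mu>.covar_lincomb_left[OF g h class_square_integrable[OF that], of a b]
    by (simp add: covar_commute)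
  then have "covariance_functional (\<lambda>x. a * g x + b * h x) =
      restrict (\<lambda>f. a * covariance_functional g f + b * covariance_functional h f) \<F>"
    unfolding covariance_functional_def by (intro restrict_ext) simp
  then show ?thesis
    unfolding derivative_def
    by (simp only: linf_lincomb[OF L covariance_functional_in_linf[OF g] covariance_functional_in_linf[OF h]])
qed

lemma derivative_bound:
  "\<exists>B>0. \<forall>h. square_integrable \<mu> h \<longrightarrow> \<bar>derivative h\<bar> \<le> B * sd \<mu> h"
proof -
  obtain C where C: "C > 0" "\<And>z B. z \<in> mspace (linf \<F>) \<Longrightarrow> (\<And>f. f \<in> \<F> \<Longrightarrow> \<bar>z f\<bar> \<le> B) \<Longrightarrow>
      0 \<le> B \<Longrightarrow> \<bar>L z\<bar> \<le> C * B"
    using linf_operator_bound[OF L] by metis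
  obtain B where B: "B \<ge> 0" "\<And>h f. square_integrable \<mu> h \<Longrightarrow> f \<in> \<F> \<Longrightarrow> \<bar>covar \<mu> f h\<bar> \<le> B * sd \<mu> h"
    using covariance_functional_bound by blast
  \<comment> \<open>The summand \<open>1\<close> makes the constant positive, so that a modulus of continuity can be divided by it.\<close>
  have "\<bar>derivative h\<bar> \<le> (C * B + 1) * sd \<mu> h" if h: "square_integrable \<mu> h" for h
  proof -
    have "\<bar>derivative h\<bar> \<le> C * (B * sd \<mu> h)"
      unfolding derivative_def using B \<mu>.sd_nonneg[OF h] h
      by (intro C(2) covariance_functional_in_linf) (auto simp: covariance_functional_def)
    also have "\<dots> \<le> (C * B + 1) * sd \<mu> h"
      using \<mu>.sd_nonneg[OF h] by (simp add: algebra_simps)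
    finally show ?thesis .
  qed
  moreover have "0 < C * B + 1" using C(1) B(1) by (simp add: add_nonneg_pos)
  ultimately show ?thesis by blast
qed

lemma derivative_continuous_linear: "continuous_linear_l2 \<mu> derivative"
proof -
  obtain B where B: "B > 0" "\<And>h. square_integrable \<mu> h \<Longrightarrow> \<bar>derivative h\<bar> \<le> B * sd \<mu> h"
    using derivative_bound by blast
  have "\<bar>derivative h - derivative g\<bar> < e"
    if "square_integrable \<mu> g" "square_integrable \<mu> h" "0 < e"
      "l2_norm \<mu> (\<lambda>x. h x - g x) < e / B" for g h e
  proof -
    have d: "square_integrable \<mu> (\<lambda>x. h x - g x)" using that by (intro square_integrable_diff)
    have "derivative (\<lambda>x. h x - g x) = derivative h - derivative g"
      using derivative_lincomb[OF that(2,1), of 1 "-1"] by simp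
    moreover have "sd \<mu> (\<lambda>x. h x - g x) \<le> l2_norm \<mu> (\<lambda>x. h x - g x)"
      unfolding l2_norm_def by (intro \<mu>.sd_le_second_moment) simp_all
    then have "sd \<mu> (\<lambda>x. h x - g x) < e / B"
      using that(4) by linarith
    then have "B * sd \<mu> (\<lambda>x. h x - g x) < e"
      using B(1) by (simp add: pos_less_divide_eq mult.commute)
    ultimately show ?thesis using B(2)[OF d] by simp
  qed
  then show ?thesis
    unfolding continuous_linear_l2_def Ball_def l2_iff
    using derivative_lincomb B(1) by (blast intro: divide_pos_pos)
qed

lemma derivative_cong_AE:
  assumes "AE x in \<mu>. h x = g x" "g \<in> borel_measurable borel" "h \<in> borel_measurable borel"
  shows "derivative h = derivative g"
proof -
  have "covar \<mu> f h = covar \<mu> f g" if "f \<in> \<F>" for f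
  proof -
    have [measurable]: "f \<in> borel_measurable \<mu>" "g \<in> borel_measurable \<mu>" "h \<in> borel_measurable \<mu>"
      using class_square_integrable[OF that] assms by (simp_all add: square_integrable_def measurable_\<mu>)
    have "\<mu>.expectation (\<lambda>x. f x * h x) = \<mu>.expectation (\<lambda>x. f x * g x)"
      using assms(1) by (intro integral_cong_AE) auto
    moreover have "\<mu>.expectation h = \<mu>.expectation g"
      using assms(1) by (intro integral_cong_AE) auto
    ultimately show ?thesis by (simp add: covar_def)
  qed
  then have "covariance_functional h = covariance_functional g"
    unfolding covariance_functional_def by (intro restrict_ext)
  then show ?thesis by (simp add: derivative_def)
qed

lemma diff_linf_tilt:
  assumes g: "g \<in> bounded_scores \<mu>" and pos: "\<And>x. 0 \<le> 1 + t * g x"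
  shows "diff_linf \<F> (tilt \<mu> (\<lambda>x. t * g x)) \<mu> = covariance_functional (\<lambda>x. t * g x)"
  unfolding diff_linf_def covariance_functional_def
proof (rule restrict_ext)
  fix f assume f: "f \<in> \<F>"
  note f_sq = class_square_integrable[OF f] and g_sq = bounded_scores_square_integrable[OF g]
  have [measurable]: "f \<in> borel_measurable \<mu>" "g \<in> borel_measurable \<mu>"
    using f_sq g_sq by (simp_all add: square_integrable_def)
  have "(\<integral>x. f x \<partial>tilt \<mu> (\<lambda>x. t * g x)) = \<mu>.expectation (\<lambda>x. (1 + t * g x) * f x)"
    unfolding tilt_def using pos by (subst integral_density) auto
  also have "\<dots> = \<mu>.expectation (\<lambda>x. f x + t * (f x * g x))"
    by (simp add: algebra_simps)
  also have "\<dots> = \<mu>.expectation f + t * \<mu>.expectation (\<lambda>x. f x * g x)"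
    using \<mu>.square_integrable_integrable[OF f_sq] square_integrable_mult[OF f_sq g_sq] by simp
  moreover have "covar \<mu> f (\<lambda>x. t * g x) = t * \<mu>.expectation (\<lambda>x. f x * g x)"
    using g by (simp add: covar_def bounded_scores_def mult.left_commute)
  ultimately show "(\<integral>x. f x \<partial>tilt \<mu> (\<lambda>x. t * g x)) - (\<integral>x. f x \<partial>\<mu>) = covar \<mu> f (\<lambda>x. t * g x)"
    by simp
qed

text \<open>The heart of the matter: \<open>L (G)\<close> and the derivative are approximated by the same \<open>k\<close>, the former through its
standard deviation and the latter in operator norm. Here \<open>k\<close> is the image of \<open>L (G \<circ> r)\<close> under \<open>G(f) \<mapsto> f\<close>.\<close>

lemma finite_approximation:
  assumes e: "0 < e"
  shows "square_integrable M (\<lambda>\<omega>. L (G \<omega>))"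
    and "\<exists>k. square_integrable \<mu> k \<and> \<bar>sd M (\<lambda>\<omega>. L (G \<omega>)) - sd \<mu> k\<bar> \<le> e \<and>
      (\<forall>h. square_integrable \<mu> h \<longrightarrow> \<bar>derivative h - covar \<mu> k h\<bar> \<le> e * sd \<mu> h)"
proof -
  let ?X = "\<lambda>\<omega>. L (G \<omega>)"
  obtain C where C: "C > 0" "\<And>z B. z \<in> mspace (linf \<F>) \<Longrightarrow> (\<And>f. f \<in> \<F> \<Longrightarrow> \<bar>z f\<bar> \<le> B) \<Longrightarrow>
      0 \<le> B \<Longrightarrow> \<bar>L z\<bar> \<le> C * B"
    using linf_operator_bound[OF L] by metis
  \<comment> \<open>One map \<open>r\<close> serves both halves: where it is close to the paths it makes \<open>L (G)\<close> close to a combination, and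
    by concentration it is close to the class under \<open>\<mu>\<close>. All \<open>d\<close> are needed, since the mean-square estimate at one
    \<open>d\<close> draws on finer approximations.\<close>
  have key: "\<exists>r. r \<in> \<F> \<rightarrow> \<F> \<and> finite (r ` \<F>) \<and>
      (\<forall>f\<in>\<F>. sd \<mu> (\<lambda>x. f x - r f x) \<le> 2 * (d / C)) \<and>
      (\<lambda>\<omega>. L (restrict (\<lambda>f. G \<omega> (r f)) \<F>)) \<in> G_combinations \<and>
      M.prob {\<omega> \<in> space M. \<bar>?X \<omega> - L (restrict (\<lambda>f. G \<omega> (r f)) \<F>)\<bar> > d} \<le> min d (1 / 4)"
    if d: "0 < d" for d
  proof -
    have "0 < d / C" "0 < min d (1 / 4)" using d C by auto
    then obtain r A where r: "r \<in> \<F> \<rightarrow> \<F>" "finite (r ` \<F>)"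
      and A: "A \<in> sets M" "1 - min d (1 / 4) \<le> M.prob A"
      and le: "\<And>\<omega> f. \<omega> \<in> A \<Longrightarrow> f \<in> \<F> \<Longrightarrow> \<bar>G \<omega> f - G \<omega> (r f)\<bar> \<le> d / C"
      using step_approximation[of "d / C" "min d (1 / 4)"] by auto
    let ?Y = "\<lambda>\<omega>. L (restrict (\<lambda>f. G \<omega> (r f)) \<F>)"
    have YG: "?Y \<in> G_combinations"
      unfolding linf_step_function[OF L r] G_combinations_def mem_Collect_eq
      by (intro exI[of _ "r ` \<F>"] exI[of _ "\<lambda>g. L (restrict (\<lambda>f. if r f = g then 1 else 0) \<F>)"]
          conjI refl r(2)) (use r(1) in auto)
    have close: "\<bar>?X \<omega> - ?Y \<omega>\<bar> \<le> d" if \<omega>: "\<omega> \<in> A" for \<omega>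
    proof -
      have G: "G \<omega> \<in> mspace (linf \<F>)"
        using \<omega> sets.sets_into_space[OF A(1)] by (intro G_in_linf) auto
      then obtain B where B: "\<And>f. f \<in> \<F> \<Longrightarrow> \<bar>G \<omega> f\<bar> \<le> B"
        unfolding mspace_linf by blast
      have Gr: "restrict (\<lambda>f. G \<omega> (r f)) \<F> \<in> mspace (linf \<F>)"
        using r B by (intro restrict_in_linf[where B = B]) auto
      have "?X \<omega> - ?Y \<omega> = L (restrict (\<lambda>f. G \<omega> f - restrict (\<lambda>f. G \<omega> (r f)) \<F> f) \<F>)"
        by (rule linf_diff[OF L G Gr, symmetric])
      moreover have "\<bar>\<dots>\<bar> \<le> C * (d / C)"
        using le[OF \<omega>] d C(1) by (intro C(2) restrict_in_linf[where B = "d / C"]) auto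
      ultimately show ?thesis using C(1) by simp
    qed
    have "M.prob {\<omega> \<in> space M. \<bar>?X \<omega> - ?Y \<omega>\<bar> > d} \<le> min d (1 / 4)"
      using G_combinationsD(3)[OF YG] LG_measurable
      by (intro M.prob_outside[OF A] close borel_measurable_diff) (auto simp: square_integrable_def)
    moreover have "sd \<mu> (\<lambda>x. f x - r f x) \<le> 2 * (d / C)" if "f \<in> \<F>" for f
      using that r A le d C(1) by (intro sd_le_of_concentration[where A = A]) auto
    ultimately show ?thesis using r YG by blast
  qed
  \<comment> \<open>The root mean square error of an approximation within \<open>d\<close> in probability is at most \<open>4 d\<close>.\<close>
  define d where "d = e / 4"
  have d: "0 < d" using e by (simp add: d_def)
  obtain r where r: "r \<in> \<F> \<rightarrow> \<F>" "finite (r ` \<F>)"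
    and sd_r: "\<And>f. f \<in> \<F> \<Longrightarrow> sd \<mu> (\<lambda>x. f x - r f x) \<le> 2 * (d / C)"
    and Y: "(\<lambda>\<omega>. L (restrict (\<lambda>f. G \<omega> (r f)) \<F>)) \<in> G_combinations"
    and P: "M.prob {\<omega> \<in> space M. \<bar>?X \<omega> - L (restrict (\<lambda>f. G \<omega> (r f)) \<F>)\<bar> > d} \<le> min d (1 / 4)"
    using key[OF d] by blast
  let ?Y = "\<lambda>\<omega>. L (restrict (\<lambda>f. G \<omega> (r f)) \<F>)"
  have dense: "\<exists>Y\<in>G_combinations. M.prob {\<omega> \<in> space M. \<bar>?X \<omega> - Y \<omega>\<bar> > d'} \<le> d'" if "0 < d'" for d'
    using key[OF that] by (meson min.boundedE)
  have L2: "integrable M (\<lambda>\<omega>. (?X \<omega> - ?Y \<omega>)\<^sup>2)"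
      "M.expectation (\<lambda>\<omega>. (?X \<omega> - ?Y \<omega>)\<^sup>2) \<le> (4 * d)\<^sup>2"
    using P d G_combinationsD G_combinations_diff dense
    by (intro M.gaussian_L2_approximation[OF LG_measurable _ _ _ Y, where e = d]; force simp: square_integrable_def)+
  have Ysq: "square_integrable M ?Y" by (rule G_combinationsD(3)[OF Y])
  have XY: "square_integrable M (\<lambda>\<omega>. ?X \<omega> - ?Y \<omega>)"
    using L2(1) LG_measurable Ysq by (auto simp: square_integrable_def)
  show X: "square_integrable M ?X"
    using square_integrable_lincomb[OF XY Ysq, of 1 1] by simp
  define c where "c g = L (restrict (\<lambda>f. if r f = g then 1 else 0) \<F>)" for g
  define k where "k = (\<lambda>x. \<Sum>g\<in>r ` \<F>. c g * g x)"
  have rF: "r ` \<F> \<subseteq> \<F>" using r by auto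
  have k: "square_integrable \<mu> k"
    unfolding k_def using r rF by (intro square_integrable_sum class_square_integrable) auto
  have "?Y = (\<lambda>\<omega>. \<Sum>g\<in>r ` \<F>. c g * G \<omega> g)"
    unfolding c_def by (simp add: linf_step_function[OF L r])
  then have "sd M ?Y = sd \<mu> k"
    unfolding k_def by (simp only: sd_G_combination[OF r(2) rF])
  moreover have "sd M (\<lambda>\<omega>. ?X \<omega> - ?Y \<omega>) \<le> e"
    using L2(2) e unfolding d_def by (intro M.sd_le_second_moment) auto
  ultimately have 1: "\<bar>sd M ?X - sd \<mu> k\<bar> \<le> e"
    using M.sd_diff_le[OF X Ysq] by linarith
  have 2: "\<bar>derivative h - covar \<mu> k h\<bar> \<le> e * sd \<mu> h" if h: "square_integrable \<mu> h" for h
  proof -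
    let ?A = "covariance_functional h"
    let ?Ar = "restrict (\<lambda>f. ?A (r f)) \<F>"
    have A: "?A \<in> mspace (linf \<F>)" by (rule covariance_functional_in_linf[OF h])
    then obtain B where "\<And>f. f \<in> \<F> \<Longrightarrow> \<bar>?A f\<bar> \<le> B"
      unfolding mspace_linf by blast
    then have Ar: "?Ar \<in> mspace (linf \<F>)"
      using r by (intro restrict_in_linf[where B = B]) auto
    have "L ?Ar = (\<Sum>g\<in>r ` \<F>. c g * ?A g)"
      unfolding c_def by (rule linf_step_function[OF L r])
    also have "\<dots> = (\<Sum>g\<in>r ` \<F>. c g * covar \<mu> g h)"
      using rF by (intro sum.cong) (auto simp: covariance_functional_def)
    also have "\<dots> = covar \<mu> k h"
      unfolding k_def
      by (rule \<mu>.covar_sum_left[OF r(2) _ h, symmetric]) (use rF in \<open>auto intro: class_square_integrable\<close>)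
    finally have kh: "L ?Ar = covar \<mu> k h" .
    have le: "\<bar>?A f - ?Ar f\<bar> \<le> 2 * (d / C) * sd \<mu> h" if f: "f \<in> \<F>" for f
    proof -
      have rf: "r f \<in> \<F>" using r f by auto
      note sq = class_square_integrable[OF f] class_square_integrable[OF rf]
      have "?A f - ?Ar f = covar \<mu> (\<lambda>x. f x - r f x) h"
        using f rf \<mu>.covar_diff_left[OF sq h] by (simp add: covariance_functional_def)
      also have "\<bar>\<dots>\<bar> \<le> sd \<mu> (\<lambda>x. f x - r f x) * sd \<mu> h"
        by (intro \<mu>.covar_Cauchy_Schwarz square_integrable_diff sq h)
      also have "\<dots> \<le> 2 * (d / C) * sd \<mu> h"
        by (intro mult_right_mono sd_r f \<mu>.sd_nonneg h)
      finally show ?thesis .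
    qed
    have "derivative h - covar \<mu> k h = L (restrict (\<lambda>f. ?A f - ?Ar f) \<F>)"
      unfolding kh[symmetric] derivative_def by (rule linf_diff[OF L A Ar, symmetric])
    also have "\<bar>\<dots>\<bar> \<le> C * (2 * (d / C) * sd \<mu> h)"
      using le d C(1) \<mu>.sd_nonneg[OF h]
      by (intro C(2) restrict_in_linf[where B = "2 * (d / C) * sd \<mu> h"]) auto
    also have "\<dots> = e / 2 * sd \<mu> h"
      using C(1) by (simp add: d_def)
    also have "\<dots> \<le> e * sd \<mu> h"
      using e \<mu>.sd_nonneg[OF h] by (intro mult_right_mono) auto
    finally show ?thesis .
  qed
  show "\<exists>k. square_integrable \<mu> k \<and> \<bar>sd M ?X - sd \<mu> k\<bar> \<le> e \<and>
      (\<forall>h. square_integrable \<mu> h \<longrightarrow> \<bar>derivative h - covar \<mu> k h\<bar> \<le> e * sd \<mu> h)"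
    using k 1 2 by blast
qed

section \<open>The efficiency bound\<close>

lemma derivative_le:
  assumes h: "square_integrable \<mu> h"
  shows "\<bar>derivative h\<bar> \<le> sd M (\<lambda>\<omega>. L (G \<omega>)) * sd \<mu> h"
proof (rule field_le_epsilon)
  fix e :: real assume e: "0 < e"
  define e' where "e' = e / (2 * (sd \<mu> h + 1))"
  have s: "0 \<le> sd \<mu> h" by (rule \<mu>.sd_nonneg[OF h])
  then have e': "0 < e'" using e by (simp add: e'_def)
  obtain k where k: "square_integrable \<mu> k" and 1: "\<bar>sd M (\<lambda>\<omega>. L (G \<omega>)) - sd \<mu> k\<bar> \<le> e'"
    and 2: "\<bar>derivative h - covar \<mu> k h\<bar> \<le> e' * sd \<mu> h"
    using finite_approximation(2)[OF e'] h by blast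
  have "\<bar>derivative h\<bar> \<le> sd \<mu> k * sd \<mu> h + e' * sd \<mu> h"
    using 2 \<mu>.covar_Cauchy_Schwarz[OF k h] by linarith
  also have "\<dots> \<le> (sd M (\<lambda>\<omega>. L (G \<omega>)) + e') * sd \<mu> h + e' * sd \<mu> h"
    using 1 s by (intro add_right_mono mult_right_mono) auto
  also have "\<dots> = sd M (\<lambda>\<omega>. L (G \<omega>)) * sd \<mu> h + e' * (2 * sd \<mu> h)"
    by (simp add: algebra_simps)
  also have "e' * (2 * sd \<mu> h) \<le> e' * (2 * (sd \<mu> h + 1))"
    using e' by (intro mult_left_mono) auto
  also have "\<dots> = e" using s by (simp add: e'_def)
  finally show "\<bar>derivative h\<bar> \<le> sd M (\<lambda>\<omega>. L (G \<omega>)) * sd \<mu> h + e" by simp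
qed

text \<open>The covariance with \<open>k\<close> is largest in the direction of \<open>k\<close> itself, and a bounded score \<open>h\<close> near \<open>k\<close> does almost as
well. The four errors \<open>e\<close> in the definition below are spent on \<open>k\<close> against \<open>L (G)\<close>, on \<open>h\<close> against \<open>k\<close> (twice),
and on the derivative against the covariance with \<open>k\<close>.\<close>

lemma derivative_nearly_attains:
  assumes a: "0 \<le> a" "a < sd M (\<lambda>\<omega>. L (G \<omega>))"
  shows "\<exists>h\<in>bounded_scores \<mu>. 0 < sd \<mu> h \<and> a * sd \<mu> h \<le> derivative h"
proof -
  let ?s = "sd M (\<lambda>\<omega>. L (G \<omega>))"
  define e where "e = (?s - a) / 4"
  have e: "0 < e" using a by (simp add: e_def)
  obtain k where k: "square_integrable \<mu> k" and 1: "\<bar>?s - sd \<mu> k\<bar> \<le> e"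
    and 2: "\<And>h. square_integrable \<mu> h \<Longrightarrow> \<bar>derivative h - covar \<mu> k h\<bar> \<le> e * sd \<mu> h"
    using finite_approximation(2)[OF e] by blast
  obtain h where hS: "h \<in> bounded_scores \<mu>" and kh: "sd \<mu> (\<lambda>x. k x - h x) \<le> e"
    using bounded_scores_dense[OF k e] by blast
  have h: "square_integrable \<mu> h" by (rule bounded_scores_square_integrable[OF hS])
  have d: "square_integrable \<mu> (\<lambda>x. k x - h x)" by (rule square_integrable_diff[OF k h])
  have "?s = a + 4 * e" by (simp add: e_def field_simps)
  moreover have "?s - sd \<mu> k \<le> e" using 1 by simp
  ultimately have sh: "sd \<mu> h \<ge> a + 2 * e"
    using \<mu>.sd_triangle[OF k h] kh by linarith
  then have pos: "0 < sd \<mu> h" using a e by linarith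
  have "covar \<mu> k h = covar \<mu> (\<lambda>x. k x - h x) h + covar \<mu> h h"
    using \<mu>.covar_diff_left[OF k h h] by simp
  moreover have "\<bar>covar \<mu> (\<lambda>x. k x - h x) h\<bar> \<le> e * sd \<mu> h"
    using \<mu>.covar_Cauchy_Schwarz[OF d h] mult_right_mono[OF kh, of "sd \<mu> h"] pos by linarith
  moreover have "covar \<mu> h h = sd \<mu> h * sd \<mu> h"
    using \<mu>.sd_power2[OF h] by (simp add: power2_eq_square)
  ultimately have "derivative h \<ge> sd \<mu> h * sd \<mu> h - 2 * e * sd \<mu> h"
    using 2[OF h] by linarith
  moreover have "(a + 2 * e) * sd \<mu> h \<le> sd \<mu> h * sd \<mu> h"
    using sh pos by (intro mult_right_mono) auto
  ultimately have "a * sd \<mu> h \<le> derivative h"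
    by (simp add: algebra_simps)
  with hS pos show ?thesis by blast
qed

lemma efficiency_bound_derivative:
  assumes D: "\<And>h. h \<in> bounded_scores \<mu> \<Longrightarrow> D h = derivative h"
  shows "efficiency_bound \<mu> (bounded_scores \<mu>) D = ennreal (M.variance (\<lambda>\<omega>. L (G \<omega>)))"
proof -
  let ?s = "sd M (\<lambda>\<omega>. L (G \<omega>))"
  let ?T = "{h \<in> bounded_scores \<mu>. l2_norm \<mu> h \<noteq> 0}"
  have X: "square_integrable M (\<lambda>\<omega>. L (G \<omega>))"
    by (rule finite_approximation(1)[OF zero_less_one])
  have s: "0 \<le> ?s" by (rule M.sd_nonneg[OF X])
  have norm_pos: "0 < sd \<mu> h" if "h \<in> ?T" for h
    using that \<mu>.sd_nonneg[OF bounded_scores_square_integrable[of h]] sd_bounded_score[of h] by simp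
  have "(SUP h\<in>?T. ennreal ((D h)\<^sup>2 / (l2_norm \<mu> h)\<^sup>2)) = ennreal (?s\<^sup>2)"
  proof (rule antisym)
    show "(SUP h\<in>?T. ennreal ((D h)\<^sup>2 / (l2_norm \<mu> h)\<^sup>2)) \<le> ennreal (?s\<^sup>2)"
    proof (rule SUP_least)
      fix h assume h: "h \<in> ?T"
      then have "\<bar>D h\<bar> \<le> ?s * sd \<mu> h"
        using derivative_le[OF bounded_scores_square_integrable] D by simp
      then have "(D h)\<^sup>2 \<le> (?s * sd \<mu> h)\<^sup>2"
        by (rule abs_le_square_iff[THEN iffD1, OF order_trans]) simp
      then have "(D h)\<^sup>2 / (sd \<mu> h)\<^sup>2 \<le> ?s\<^sup>2"
        using norm_pos[OF h] by (simp add: divide_le_eq power_mult_distrib)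
      then show "ennreal ((D h)\<^sup>2 / (l2_norm \<mu> h)\<^sup>2) \<le> ennreal (?s\<^sup>2)"
        using h by (simp add: sd_bounded_score ennreal_leI)
    qed
    show "ennreal (?s\<^sup>2) \<le> (SUP h\<in>?T. ennreal ((D h)\<^sup>2 / (l2_norm \<mu> h)\<^sup>2))"
    proof (rule dense_le)
      fix y assume y: "y < ennreal (?s\<^sup>2)"
      then obtain b where b: "0 \<le> b" "y = ennreal b"
        by (cases y) auto
      have "sqrt b < ?s"
        using y b s by (intro real_less_lsqrt) (auto simp: ennreal_less_iff)
      then obtain h where h: "h \<in> bounded_scores \<mu>" "0 < sd \<mu> h" "sqrt b * sd \<mu> h \<le> derivative h"
        using derivative_nearly_attains[of "sqrt b"] b by auto
      have "(sqrt b * sd \<mu> h)\<^sup>2 \<le> (D h)\<^sup>2"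
        unfolding D[OF h(1)] using h b by (intro power_mono) auto
      then have "b \<le> (D h)\<^sup>2 / (sd \<mu> h)\<^sup>2"
        using h(2) b by (simp add: le_divide_eq power_mult_distrib)
      then have "y \<le> ennreal ((D h)\<^sup>2 / (l2_norm \<mu> h)\<^sup>2)"
        using b h by (simp add: sd_bounded_score ennreal_leI)
      also have "\<dots> \<le> (SUP h\<in>?T. ennreal ((D h)\<^sup>2 / (l2_norm \<mu> h)\<^sup>2))"
        using h by (intro SUP_upper) (auto simp: sd_bounded_score)
      finally show "y \<le> (SUP h\<in>?T. ennreal ((D h)\<^sup>2 / (l2_norm \<mu> h)\<^sup>2))" .
    qed
  qed
  moreover have "?s\<^sup>2 = M.variance (\<lambda>\<omega>. L (G \<omega>))"
    using M.sd_power2[OF X] M.covar_eq_variance[OF X] by simp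
  ultimately show ?thesis
    by (simp add: efficiency_bound_def lin_bounded_scores)
qed

end

theorem proposition2:
  fixes \<F> :: "('a::topological_space \<Rightarrow> real) set"
    and F :: "'a \<Rightarrow> real"
    and \<mu> :: "'a measure"
    and P0 :: "'a measure set"
    and \<delta> :: "'a measure \<Rightarrow> real"
    and M :: "'b measure"
    and G :: "'b \<Rightarrow> ('a \<Rightarrow> real) \<Rightarrow> real"
    and \<delta>' :: "(('a \<Rightarrow> real) \<Rightarrow> real) \<Rightarrow> real"
  assumes "\<F> \<subseteq> borel_measurable borel"
    and "envelope \<F> F"
    and "P0 \<subseteq> space (prob_algebra borel)"
    and "convex_measures P0"
    and "\<mu> \<in> P0"
    and "\<And>\<nu>. \<nu> \<in> P0 \<Longrightarrow> integrable \<nu> F"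
    and a: "pre_gaussian_process \<mu> \<F> M G"
    and b: "\<And>h. h \<in> bounded_scores \<mu> \<Longrightarrow> \<forall>\<^sub>F t in at_right 0. tilt \<mu> (\<lambda>x. t * h x) \<in> P0"
    and c: "continuous_linear_linf \<F> \<delta>'"
      "\<And>\<nu> h. \<nu> \<in> P0 \<Longrightarrow> h \<in> bounded_scores \<mu> \<Longrightarrow> \<nu> = tilt \<mu> h \<Longrightarrow>
        ((\<lambda>t. (\<delta> (mixture t \<mu> \<nu>) - \<delta> \<mu>) / t) \<longlongrightarrow> \<delta>' (diff_linf \<F> \<nu> \<mu>)) (at_right 0)"
  shows "tangent_space P0 \<mu> (linear_submodels \<mu>) (bounded_scores \<mu>) \<and>
    (\<exists>D. has_pathwise_derivative \<delta> \<mu> (linear_submodels \<mu>) (bounded_scores \<mu>) D) \<and>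
    (\<forall>D. has_pathwise_derivative \<delta> \<mu> (linear_submodels \<mu>) (bounded_scores \<mu>) D \<longrightarrow>
      efficiency_bound \<mu> (bounded_scores \<mu>) D =
        ennreal (prob_space.variance M (\<lambda>\<omega>. \<delta>' (G \<omega>))))"
proof -
  have "borel_prob_space \<mu>"
    using assms(3,5) by (intro borel_prob_space.intro) (auto simp: space_prob_algebra)
  then interpret pre_gaussian_functional \<mu> \<F> M G \<delta>'
    using assms(1) a c(1)
    by (intro pre_gaussian_functional.intro pre_gaussian_functional_axioms.intro)
  let ?T = "bounded_scores \<mu>" and ?C = "linear_submodels \<mu>"

  \<comment> \<open>Only the mixture path towards \<open>(1 + s g) \<mu>\<close> is covered by the hypothesis; substituting \<open>t / s\<close> for its
    parameter gives the tilted path of \<open>g\<close>.\<close>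
  have limit: "((\<lambda>t. (\<delta> (tilt \<mu> (\<lambda>x. t * g x)) - \<delta> \<mu>) / t) \<longlongrightarrow> derivative g) (at_right 0)"
    if g: "g \<in> ?T" for g
  proof -
    obtain B where B: "0 < B" "\<And>x. \<bar>g x\<bar> \<le> B"
      "\<And>t x. 0 \<le> t \<Longrightarrow> t * B \<le> 1 / 2 \<Longrightarrow> 1 / 2 \<le> 1 + t * g x"
      using bounded_score_bound[OF g] by blast
    have g_sq: "square_integrable \<mu> g" by (rule bounded_scores_square_integrable[OF g])
    obtain s where s: "0 < s" "s * B \<le> 1 / 2" and s_P0: "tilt \<mu> (\<lambda>x. s * g x) \<in> P0"
      using eventually_happens[OF eventually_conj[OF b[OF g] eventually_small[of B "1 / 2"]]] B(1) by auto
    have pos: "0 \<le> 1 + s * g x" for x using B(3)[of s x] s by linarith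
    have sg: "(\<lambda>x. s * g x) \<in> ?T"
    proof -
      have "bounded (range (\<lambda>x. s * g x))"
        using B(2) s(1) by (auto simp: bounded_iff abs_mult intro!: exI[of _ "s * B"] mult_left_mono)
      then show ?thesis using g by (auto simp: bounded_scores_def)
    qed
    have lim: "((\<lambda>t. (\<delta> (mixture t \<mu> (tilt \<mu> (\<lambda>x. s * g x))) - \<delta> \<mu>) / t) \<longlongrightarrow>
        \<delta>' (diff_linf \<F> (tilt \<mu> (\<lambda>x. s * g x)) \<mu>)) (at_right 0)"
      by (rule c(2)[OF s_P0 sg refl])
    have ev: "\<forall>\<^sub>F t in at_right 0. (\<delta> (mixture t \<mu> (tilt \<mu> (\<lambda>x. s * g x))) - \<delta> \<mu>) / t =
        (\<delta> (tilt \<mu> (\<lambda>x. (t * s) * g x)) - \<delta> \<mu>) / t"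
      using eventually_small[of 1 1]
    proof (rule_tac eventually_mono)
      fix t :: real assume "0 < t \<and> t * 1 \<le> 1"
      then show "(\<delta> (mixture t \<mu> (tilt \<mu> (\<lambda>x. s * g x))) - \<delta> \<mu>) / t =
          (\<delta> (tilt \<mu> (\<lambda>x. (t * s) * g x)) - \<delta> \<mu>) / t"
        using mixture_tilt[of "\<lambda>x. s * g x" t] pos sg
        by (simp add: bounded_scores_def mult.assoc)
    qed auto
    have val: "\<delta>' (diff_linf \<F> (tilt \<mu> (\<lambda>x. s * g x)) \<mu>) = s * derivative g"
      unfolding diff_linf_tilt[OF g pos]
      using derivative_lincomb[OF g_sq g_sq, of s 0] by (simp add: derivative_def)
    have "((\<lambda>t. (\<delta> (tilt \<mu> (\<lambda>x. (t * s) * g x)) - \<delta> \<mu>) / t) \<longlongrightarrow> s * derivative g) (at_right 0)"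
      by (rule tendsto_cong[OF ev, THEN iffD1, OF lim[unfolded val]])
    moreover have "filterlim (\<lambda>t. t / s) (at_right 0) (at_right 0)"
    proof -
      have "((\<lambda>t. t / s) \<longlongrightarrow> 0 / s) (at_right 0)"
        using s(1) by (intro tendsto_intros) auto
      moreover have "\<forall>\<^sub>F t in at_right 0. t / s \<in> {0<..}"
        using eventually_at_right_less[of 0] by eventually_elim (use s(1) in simp)
      ultimately show ?thesis
        using s(1) by (auto simp: filterlim_at elim!: eventually_mono)
    qed
    ultimately have "((\<lambda>t. (\<delta> (tilt \<mu> (\<lambda>x. (t / s * s) * g x)) - \<delta> \<mu>) / (t / s)) \<longlongrightarrow> s * derivative g) (at_right 0)"
      by (rule filterlim_compose)
    then have "((\<lambda>t. (1 / s) * ((\<delta> (tilt \<mu> (\<lambda>x. (t / s * s) * g x)) - \<delta> \<mu>) / (t / s))) \<longlongrightarrow>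
        (1 / s) * (s * derivative g)) (at_right 0)"
      by (intro tendsto_mult tendsto_const)
    then show ?thesis using s(1) by simp
  qed

  \<comment> \<open>The submodel \<open>m\<close> may be indexed by another representative \<open>g\<close> of the same score.\<close>
  have derivative: "((\<lambda>t. (\<delta> (m t) - \<delta> \<mu>) / t) \<longlongrightarrow> derivative h) (at_right 0)"
    if h: "h \<in> ?T" and m: "m \<in> ?C" and score: "has_score \<mu> m h" for h m
  proof -
    obtain g where g: "g \<in> ?T" and m_eq: "m = (\<lambda>t. tilt \<mu> (\<lambda>x. t * g x))"
      using m by (auto simp: linear_submodels_def)
    have "AE x in \<mu>. h x = g x"
      using has_score_unique[OF g] score m_eq by simp
    then have "derivative h = derivative g"
      using g h by (intro derivative_cong_AE) (auto simp: bounded_scores_def)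
    with limit[OF g] show ?thesis by (simp add: m_eq)
  qed

  have "tangent_set P0 \<mu> ?C ?T"
  proof -
    have "submodel P0 \<mu> (\<lambda>t. tilt \<mu> (\<lambda>x. t * g x))" if g: "g \<in> ?T" for g
    proof -
      have 0: "tilt \<mu> (\<lambda>x. 0 * g x) = \<mu>" by (simp add: tilt_def density_1)
      obtain \<epsilon> where \<epsilon>: "0 < \<epsilon>" "\<And>t. 0 < t \<Longrightarrow> t < \<epsilon> \<Longrightarrow> tilt \<mu> (\<lambda>x. t * g x) \<in> P0"
        using b[OF g] unfolding eventually_at_right_field by blast
      have "tilt \<mu> (\<lambda>x. t * g x) \<in> P0" if "0 \<le> t" "t < \<epsilon>" for t
        using that \<epsilon>(2)[of t] 0 assms(5) by (cases "t = 0") auto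
      with 0 \<epsilon>(1) show ?thesis unfolding submodel_def by blast
    qed
    then show ?thesis
      using has_score_linear bounded_scores_square_integrable
      unfolding tangent_set_def linear_submodels_def by (auto simp: l2_iff)
  qed
  then have "tangent_space P0 \<mu> ?C ?T"
    by (simp add: tangent_space_def lin_bounded_scores)
  moreover have "has_pathwise_derivative \<delta> \<mu> ?C ?T derivative"
    unfolding has_pathwise_derivative_def
    using derivative derivative_continuous_linear by blast
  moreover have "efficiency_bound \<mu> ?T D = ennreal (M.variance (\<lambda>\<omega>. \<delta>' (G \<omega>)))"
    if D: "has_pathwise_derivative \<delta> \<mu> ?C ?T D" for D
  proof (rule efficiency_bound_derivative)
    fix h assume h: "h \<in> ?T"
    let ?m = "\<lambda>t. tilt \<mu> (\<lambda>x. t * h x)"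
    have m: "?m \<in> ?C" using h by (auto simp: linear_submodels_def)
    have "((\<lambda>t. (\<delta> (?m t) - \<delta> \<mu>) / t) \<longlongrightarrow> D h) (at_right 0)"
      using D h m has_score_linear[OF h] unfolding has_pathwise_derivative_def by blast
    then show "D h = derivative h"
      using limit[OF h] by (intro tendsto_unique[OF trivial_limit_at_right_real]) auto
  qed
  ultimately show ?thesis by blast
qed

end
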